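(* Let $(\mathcal{A},\mathcal{B})$ be a generalized $\mathcal{M}$-tensor pair, with $\mathcal{A},\mathcal{B}\in T_{m,n}$, and let $\{\mathbf{x}_k\}$, $\{\mathbf{y}_k\}$, $\{\rho_k\}$, $\{\bar s_k\}$, $\{\bar\rho_k\}$ be generated by the Modified Tensor Noda Iteration (MTNI). Then the limits $\lambda=\lim_{k\to\infty}\bar\rho_k$ and $\mathbf{x}_*=\lim_{k\to\infty}\mathbf{x}_k$ exist, $\lambda$ is the unique positive generalized eigenvalue of the tensor pair $(\mathcal{A},\mathcal{B})$ corresponding to a positive generalized eigenvector, and $\mathbf{x}_*$ is the corresponding positive eigenvector, i.e. $\mathcal{A}\mathbf{x}_*^{m-1}=\lambda\mathcal{B}\mathbf{x}_*^{m-1}$.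
   Context: $T_{m,n}$ is the set of all $m$th order $n$-dimensional real tensors $\mathcal{A}=(a_{i_1\ldots i_m})$, $i_1,\ldots,i_m\in\{1,\ldots,n\}$. For $\mathbf{x}\in\mathbb{R}^n$, $\mathcal{A}\mathbf{x}^{m-1}\in\mathbb{R}^n$ is the vector with $i$-th entry $\sum_{i_2,\ldots,i_m=1}^n a_{ii_2\cdots i_m}x_{i_2}\cdots x_{i_m}$. Inequalities between vectors or tensors are entrywise; $\frac{\mathbf{x}}{\mathbf{y}}$ is the entrywise quotient; $\max\mathbf{x}$ and $\min\mathbf{x}$ are the largest and smallest entries; $\|\cdot\|$ is the 2-norm. A number $t$ is a generalized eigenvalue of $(\mathcal{A},\mathcal{B})$ with generalized eigenvector $\mathbf{x}\ne\mathbf{0}$ if $\mathcal{A}\mathbf{x}^{m-1}=t\mathcal{B}\mathbf{x}^{m-1}$. $\mathcal{A}$ is weakly irreducible if for every nonempty proper subset $S\subset\{1,\ldots,n\}$ there exist $i_1\in S$ and $i_2,\ldots,i_m$ with at least one $i_q\notin S$ ($2\le q\le m$) such that $a_{i_1i_2\ldots i_m}\ne0$. $(\mathcal{A},\mathcal{B})$ is a generalized $\mathcal{M}$-tensor pair if: (1) $\mathcal{A}\ge 0$; (2) $\mathcal{A}$ is weakly irreducible; (3) there is $\mathbf{v}\in\mathbb{R}^n$, $\mathbf{v}>0$, with $\mathcal{B}\mathbf{v}^{m-1}>\mathcal{A}\mathbf{v}^{m-1}$; (4) $b_{ii_2\ldots i_m}\le a_{ii_2\ldots i_m}$ for all $i$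 and all $(i_2,\ldots,i_m)\ne(i,\ldots,i)$. MTNI: fix $\varepsilon>0$ and $\mathbf{b}>0$. Let $\mathbf{x}_0=\hat{\mathbf{x}}/\|\hat{\mathbf{x}}\|$, where $\hat{\mathbf{x}}$ is the unique positive solution of $(\mathcal{B}-\mathcal{A})\hat{\mathbf{x}}^{m-1}=\mathbf{b}$, and $\rho_0=\max\frac{\mathcal{A}\mathbf{x}_0^{m-1}}{\mathcal{B}\mathbf{x}_0^{m-1}}$. For $k=1,2,\ldots$: $\mathbf{y}_k$ is the positive solution of $(\rho_{k-1}\mathcal{B}-\mathcal{A})\mathbf{y}_k^{m-1}=(\mathcal{B}-\mathcal{A})\mathbf{x}_{k-1}^{m-1}$; $\tau_{k-1}=\min\frac{(\mathcal{B}-\mathcal{A})\mathbf{x}_{k-1}^{m-1}}{(\mathcal{B}-\mathcal{A})\mathbf{y}_k^{m-1}}$; $\rho_k=(1+\varepsilon)\Big(\rho_{k-1}-\frac{(1-\rho_{k-1})\tau_{k-1}}{1-\tau_{k-1}}\Big)$; $\mathbf{x}_k=\mathbf{y}_k/\|\mathbf{y}_k\|$; $\bar s_k=\max\frac{\mathcal{A}\mathbf{x}_k^{m-1}}{(\mathcal{B}-\mathcal{A})\mathbf{x}_k^{m-1}}$; $\bar\rho_k=\bar s_k/(1+\bar s_k)$. The iteration is run without a stopping test, so the sequences are infinite.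
   Formalization: The formal theorem adds the assumption ρ_1 < 1 (true for all sufficiently small ε, e.g. (1+ε)ρ_0 ≤ 1); for arbitrary ε > 0 the claim fails, e.g. m=n=2, A=[[0,1],[1,0]], B all ones, ε=3/2, b=(1+1/√5, 1−1/√5), where the iteration cycles. *)

theory Defs
  imports "HOL-Analysis.Analysis"
begin

text \<open>
  A tensor of order \<open>m\<close> and dimension \<open>CARD('n)\<close> is a real-valued function on index lists. The
  order \<open>m\<close> is passed explicitly, and only the values on lists of length \<open>m\<close> matter. The
  leading index \<open>i\<^sub>1\<close> is the head of the list, and \<open>i\<^sub>2, \<dots>, i\<^sub>m\<close> form its tail, of length \<open>m - 1\<close>.
\<close>

type_synonym 'n tensor = "'n list \<Rightarrow> real"

definition tensor_app :: "nat \<Rightarrow> 'n::finite tensor \<Rightarrow> real ^ 'n \<Rightarrow> real ^ 'n" where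
  "tensor_app m A x =
     (\<chi> i. \<Sum>js | length js = m - 1. A (i # js) * prod_list (map (\<lambda>j. x $ j) js))"

definition tensor_diff :: "'n tensor \<Rightarrow> 'n tensor \<Rightarrow> 'n tensor" where
  "tensor_diff A B = (\<lambda>is. A is - B is)"

definition tensor_scale :: "real \<Rightarrow> 'n tensor \<Rightarrow> 'n tensor" where
  "tensor_scale c A = (\<lambda>is. c * A is)"

text \<open>
  The library's \<open><\<close> on \<open>real ^ 'n\<close> means \<open>\<le>\<close> and \<open>\<noteq>\<close>; the strict entrywise order needed here
  is a different relation.
\<close>

definition vec_less :: "real ^ 'n::finite \<Rightarrow> real ^ 'n \<Rightarrow> bool" where
  "vec_less x y \<longleftrightarrow> (\<forall>i. x $ i < y $ i)"

definition vec_quot :: "real ^ 'n::finite \<Rightarrow> real ^ 'n \<Rightarrow> real ^ 'n" where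
  "vec_quot x y = (\<chi> i. x $ i / y $ i)"

definition vec_max :: "real ^ 'n::finite \<Rightarrow> real" where
  "vec_max x = Max (range (\<lambda>i. x $ i))"

definition vec_min :: "real ^ 'n::finite \<Rightarrow> real" where
  "vec_min x = Min (range (\<lambda>i. x $ i))"

definition gen_eigenpair ::
  "nat \<Rightarrow> 'n::finite tensor \<Rightarrow> 'n tensor \<Rightarrow> real \<Rightarrow> real ^ 'n \<Rightarrow> bool" where
  "gen_eigenpair m A B t x \<longleftrightarrow> x \<noteq> 0 \<and> tensor_app m A x = t *\<^sub>R tensor_app m B x"

definition nonneg_tensor :: "nat \<Rightarrow> 'n tensor \<Rightarrow> bool" where
  "nonneg_tensor m A \<longleftrightarrow> (\<forall>is. length is = m \<longrightarrow> 0 \<le> A is)"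

definition weakly_irreducible :: "nat \<Rightarrow> 'n tensor \<Rightarrow> bool" where
  "weakly_irreducible m A \<longleftrightarrow>
     (\<forall>S. S \<noteq> {} \<and> S \<noteq> UNIV \<longrightarrow>
        (\<exists>i\<in>S. \<exists>js. length js = m - 1 \<and> (\<exists>j\<in>set js. j \<notin> S) \<and> A (i # js) \<noteq> 0))"

definition gen_M_pair :: "nat \<Rightarrow> 'n::finite tensor \<Rightarrow> 'n tensor \<Rightarrow> bool" where
  "gen_M_pair m A B \<longleftrightarrow>
     nonneg_tensor m A \<and>
     weakly_irreducible m A \<and>
     (\<exists>v. vec_less 0 v \<and> vec_less (tensor_app m A v) (tensor_app m B v)) \<and>
     (\<forall>i js. length js = m - 1 \<and> js \<noteq> replicate (m - 1) i \<longrightarrow> B (i # js) \<le> A (i # js))"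

text \<open>
  The predicate below says that the given infinite sequences are a run of the Modified Tensor Noda
  Iteration. The values \<open>y 0\<close>, \<open>sbar 0\<close> and \<open>rhobar 0\<close> are not part of the run and stay
  unconstrained.

  For a generalized M-tensor pair, \<open>0 < \<rho> k < 1\<close> makes every denominator positive. The first shift
  satisfies \<open>\<rho> 0 < 1\<close> automatically. Later ones are \<open>\<rho> (Suc k) = (1 + \<epsilon>) * rhobar (Suc k)\<close> and can
  exceed 1 if \<open>\<epsilon>\<close> is large. Then \<open>\<rho> B - A\<close> need no longer have nonpositive off-diagonal entries,
  and the iteration can cycle. If \<open>\<rho> 1 < 1\<close>, then all shifts are below 1, because \<open>rhobar\<close> is
  nonincreasing; \<open>(1 + \<epsilon>) * \<rho> 0 \<le> 1\<close> is sufficient for \<open>\<rho> 1 < 1\<close>.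
\<close>

definition MTNI ::
  "nat \<Rightarrow> 'n::finite tensor \<Rightarrow> 'n tensor \<Rightarrow> real \<Rightarrow> real ^ 'n \<Rightarrow>
   (nat \<Rightarrow> real ^ 'n) \<Rightarrow> (nat \<Rightarrow> real ^ 'n) \<Rightarrow>
   (nat \<Rightarrow> real) \<Rightarrow> (nat \<Rightarrow> real) \<Rightarrow> (nat \<Rightarrow> real) \<Rightarrow> (nat \<Rightarrow> real) \<Rightarrow> bool" where
  "MTNI m A B \<epsilon> b x y \<rho> \<tau> sbar rhobar \<longleftrightarrow>
     (\<exists>xhat. vec_less 0 xhat \<and> tensor_app m (tensor_diff B A) xhat = b \<and>
        x 0 = xhat /\<^sub>R norm xhat) \<and>
     \<rho> 0 = vec_max (vec_quot (tensor_app m A (x 0)) (tensor_app m B (x 0))) \<and>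
     (\<forall>k.
        vec_less 0 (y (Suc k)) \<and>
        tensor_app m (tensor_diff (tensor_scale (\<rho> k) B) A) (y (Suc k))
          = tensor_app m (tensor_diff B A) (x k) \<and>
        \<tau> k = vec_min (vec_quot (tensor_app m (tensor_diff B A) (x k))
                                (tensor_app m (tensor_diff B A) (y (Suc k)))) \<and>
        \<rho> (Suc k) = (1 + \<epsilon>) * (\<rho> k - (1 - \<rho> k) * \<tau> k / (1 - \<tau> k)) \<and>
        x (Suc k) = y (Suc k) /\<^sub>R norm (y (Suc k)) \<and>
        sbar (Suc k) = vec_max (vec_quot (tensor_app m A (x (Suc k)))
                                (tensor_app m (tensor_diff B A) (x (Suc k)))) \<and>
        rhobar (Suc k) = sbar (Suc k) / (1 + sbar (Suc k)))"

end

theory Submission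
  imports Defs
begin

text \<open>
  Put \<open>M = B - A\<close>. Then \<open>A v = t (B v)\<close> is the same as \<open>A v = s (M v)\<close> with \<open>t = s / (1 + s)\<close>, and
  \<open>M\<close> is a Z-tensor: its off-diagonal entries are nonpositive, because those of \<open>B\<close> are at most those
  of \<open>A\<close>. One step of MTNI is,
  up to a positive factor, the Noda step \<open>(\<sigma> M - A) x' = d (M x)\<close> with shift \<open>\<sigma> = \<rho> / (1 - \<rho>)\<close>,
  and the update rule for \<open>\<rho>\<close> says that \<open>\<rho>\<close> is \<open>1 + \<epsilon>\<close> times the current \<open>rhobar\<close>
  (lemma \<open>mtni_step\<close>). As long as \<open>\<rho> < 1\<close>, the factor \<open>1 + \<epsilon>\<close> keeps \<open>\<sigma>\<close> strictly above
  \<open>s = max (A x / M x)\<close>.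

  Every argument about Z-tensors rests on one observation. If \<open>v \<le> u\<close> and \<open>u\<close>, \<open>v\<close> agree at the
  coordinate \<open>i\<close>, then \<open>(F u)\<^sub>i \<le> (F v)\<^sub>i\<close> for a Z-tensor \<open>F\<close>. Scaling one positive vector until it
  touches another from below yields a comparison principle, and with weak irreducibility also a
  strong maximum principle. Both apply to \<open>F = \<sigma> M - A\<close>. They show that a Noda step does not
  increase \<open>s\<close>, and that it makes \<open>A x'\<close> strictly smaller than \<open>s (M x')\<close> in every
  coordinate unless \<open>x\<close> is already an eigenvector (lemma \<open>noda_step\<close>). In particular all shifts
  stay below 1 once \<open>\<rho> 1\<close> is.

  So \<open>s\<close> decreases to a limit \<open>l\<close>. Weak irreducibility gives a Harnack inequality: the ratio of any
  two coordinates of an iterate is bounded by a constant, so the normalized iterates stay in a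
  compact set of positive vectors. Let \<open>x\<close> tend to \<open>z\<close> and its successor to \<open>z'\<close> along a
  subsequence. If \<open>z\<close> were not an eigenvector, the limiting Noda step would give
  \<open>A z' < l (M z')\<close> everywhere; this persists at a nearby iterate, whose value of \<open>s\<close> is then below
  the limit \<open>l\<close>. Hence every subsequential limit is a unit positive eigenvector for \<open>l\<close>. There is only
  one such vector by the strong maximum principle, and the whole sequence converges to it
  (lemma \<open>noda_converges\<close>). Uniqueness of the eigenvalue is again a touching argument.

  In dimension 1 the first vector \<open>x 0\<close> is already an eigenvector with eigenvalue \<open>\<rho> 0\<close>, the equation
  for \<open>y 1\<close> has no solution, and there is no run to consider.
\<close>

section \<open>Tensors acting on vectors\<close>

definition Z_tensor :: "nat \<Rightarrow> 'n tensor \<Rightarrow> bool" where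
  "Z_tensor m F \<longleftrightarrow>
     (\<forall>i js. length js = m - 1 \<and> js \<noteq> replicate (m - 1) i \<longrightarrow> F (i # js) \<le> 0)"

lemma finite_index_lists: "finite {js :: 'n::finite list. length js = k}"
  using finite_lists_length_eq[of "UNIV :: 'n set" k] by simp

lemma tensor_app_diff:
  "tensor_app m (tensor_diff A B) x = tensor_app m A x - tensor_app m B x"
  by (simp add: tensor_app_def tensor_diff_def vec_eq_iff sum_subtractf algebra_simps)

lemma tensor_app_scale:
  "tensor_app m (tensor_scale c A) x = c *\<^sub>R tensor_app m A x"
  by (simp add: tensor_app_def tensor_scale_def vec_eq_iff sum_distrib_left algebra_simps)

lemma prod_list_map_scale:
  "prod_list (map (\<lambda>j. c * f j) js) = c ^ length js * prod_list (map f js)"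
  for c :: real
  by (induction js) (auto simp: algebra_simps)

lemma tensor_app_scaleR:
  "tensor_app m A (c *\<^sub>R x) = c ^ (m - 1) *\<^sub>R tensor_app m A x"
proof -
  have "A (i # js) * prod_list (map (\<lambda>j. (c *\<^sub>R x) $ j) js)
      = c ^ (m - 1) * (A (i # js) * prod_list (map (\<lambda>j. x $ j) js))"
    if "length js = m - 1" for i js
    using that prod_list_map_scale[of c "\<lambda>j. x $ j" js] by simp
  then have "tensor_app m A (c *\<^sub>R x) $ i = c ^ (m - 1) * tensor_app m A x $ i" for i
    unfolding tensor_app_def vec_lambda_beta sum_distrib_left by (intro sum.cong) blast+
  then show ?thesis by (simp add: vec_eq_iff)
qed

lemma continuous_tensor_app:
  fixes x :: "real ^ 'n::finite"
  shows "isCont (tensor_app m A) x"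
proof -
  have "isCont (\<lambda>x::real^'n. prod_list (map (\<lambda>j. x $ j) js)) x" for js
    by (induction js) (auto intro!: continuous_intros)
  then show ?thesis
    unfolding tensor_app_def continuous_at
    by (intro tendsto_vec_lambda tendsto_sum tendsto_mult tendsto_const) auto
qed

lemma prod_list_map_mono:
  fixes f g :: "'b \<Rightarrow> real"
  assumes "\<And>j. j \<in> set js \<Longrightarrow> 0 \<le> f j" and "\<And>j. j \<in> set js \<Longrightarrow> f j \<le> g j"
  shows "prod_list (map f js) \<le> prod_list (map g js) \<and> 0 \<le> prod_list (map f js)"
  using assms
proof (induction js)
  case (Cons a js)
  then have "prod_list (map f js) \<le> prod_list (map g js)" "0 \<le> prod_list (map f js)"
    by auto
  moreover have "0 \<le> f a" "f a \<le> g a" using Cons.prems by auto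
  ultimately show ?case
    by (auto intro!: mult_mono)
qed auto

lemma prod_list_map_pos:
  fixes f :: "'b \<Rightarrow> real"
  assumes "\<And>j. 0 < f j"
  shows "0 < prod_list (map f js)"
  using assms by (induction js) auto

lemma prod_list_map_strict_mono:
  fixes f g :: "'b \<Rightarrow> real"
  assumes pos: "\<And>j. 0 < f j" and le: "\<And>j. f j \<le> g j" and j: "j \<in> set js" "f j < g j"
  shows "prod_list (map f js) < prod_list (map g js)"
proof -
  obtain as bs where js: "js = as @ j # bs" using split_list[OF j(1)] by blast
  have as: "prod_list (map f as) \<le> prod_list (map g as)" "0 < prod_list (map f as)"
    and bs: "prod_list (map f bs) \<le> prod_list (map g bs)" "0 < prod_list (map f bs)"
    using prod_list_map_mono[of _ f g] pos le prod_list_map_pos[of f] by (auto simp: less_imp_le)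
  have "f j * prod_list (map f bs) < g j * prod_list (map g bs)"
    using bs j(2) pos[of j] by (intro mult_less_le_imp_less) auto
  then show ?thesis
    using as bs pos[of j] le[of j] unfolding js
    by (auto intro!: mult_le_less_imp_less)
qed

lemma tensor_app_mono:
  assumes A: "nonneg_tensor m A" "1 \<le> m" and v: "\<And>j. 0 \<le> v $ j" and vu: "\<And>j. v $ j \<le> u $ j"
  shows "tensor_app m A v $ i \<le> tensor_app m A u $ i"
proof -
  have "A (i # js) * prod_list (map (($) v) js) \<le> A (i # js) * prod_list (map (($) u) js)"
    if "length js = m - 1" for js
    using A that prod_list_map_mono[of js "($) v" "($) u"] v vu
    by (intro mult_left_mono) (simp_all add: nonneg_tensor_def)
  then show ?thesis by (auto simp: tensor_app_def intro!: sum_mono)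
qed

lemma weakly_irreducible_row:
  fixes A :: "'n::finite tensor"
  assumes "weakly_irreducible m A" "1 < CARD('n)"
  obtains j js where "length js = m - 1" "j \<in> set js" "j \<noteq> i" "A (i # js) \<noteq> 0"
proof -
  have "{i} \<noteq> (UNIV :: 'n set)"
  proof
    assume "{i} = (UNIV :: 'n set)"
    then have "CARD('n) = card {i}" by simp
    with assms(2) show False by simp
  qed
  then obtain js j where "length js = m - 1" "j \<in> set js" "j \<noteq> i" "A (i # js) \<noteq> 0"
    using assms(1)[unfolded weakly_irreducible_def, THEN spec[of _ "{i}"]] by auto
  then show ?thesis by (rule that)
qed

text \<open>
  Every row has a nonzero entry with an index off the diagonal, and a row entry that is nonzero
  contributes a strictly increasing monomial on positive vectors.
\<close>
lemma tensor_app_strict_mono: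
  fixes A :: "'n::finite tensor"
  assumes A: "nonneg_tensor m A" "1 \<le> m" "weakly_irreducible m A" "1 < CARD('n)"
    and v: "\<And>j. 0 < v $ j" and vu: "\<And>j. v $ j < u $ j"
  shows "tensor_app m A v $ i < tensor_app m A u $ i"
proof -
  obtain j js where j: "length js = m - 1" "j \<in> set js" "A (i # js) \<noteq> 0"
    using weakly_irreducible_row[OF A(3,4)] by metis
  then have Apos: "0 < A (i # js)" using A(1,2)
    unfolding nonneg_tensor_def by (simp add: order_less_le)
  have "(\<Sum>js | length js = m - 1. A (i # js) * prod_list (map (($) v) js))
      < (\<Sum>js | length js = m - 1. A (i # js) * prod_list (map (($) u) js))"
  proof (rule sum_strict_mono_ex1[OF finite_index_lists])
    show "\<forall>js\<in>{js. length js = m - 1}. A (i # js) * prod_list (map (($) v) js)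
             \<le> A (i # js) * prod_list (map (($) u) js)"
      using A(1,2) v vu prod_list_map_mono[of _ "\<lambda>j. v $ j" "\<lambda>j. u $ j"]
      by (auto simp: nonneg_tensor_def less_imp_le intro!: mult_left_mono)
    have "A (i # js) * prod_list (map (($) v) js) < A (i # js) * prod_list (map (($) u) js)"
      using Apos prod_list_map_strict_mono[of "($) v" "($) u" j js] v vu j by (simp add: less_imp_le)
    then show "\<exists>js\<in>{js. length js = m - 1}. A (i # js) * prod_list (map (($) v) js)
             < A (i # js) * prod_list (map (($) u) js)"
      using j(1) by blast
  qed
  then show ?thesis by (simp add: tensor_app_def)
qed

lemma tensor_app_pos:
  fixes A :: "'n::finite tensor"
  assumes A: "nonneg_tensor m A" "1 \<le> m" "weakly_irreducible m A" "1 < CARD('n)"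
    and v: "\<And>j. 0 < v $ j"
  shows "0 < tensor_app m A v $ i"
proof -
  \<comment> \<open>Strict monotonicity against a smaller positive vector, whose image is nonnegative.\<close>
  have *: "0 < (1/2) *\<^sub>R v $ j" "((1/2) *\<^sub>R v) $ j < v $ j" for j using v[of j] by auto
  have "tensor_app m A ((1/2) *\<^sub>R v) $ i < tensor_app m A v $ i"
    by (rule tensor_app_strict_mono[OF A]) (use * in auto)
  moreover have "0 \<le> tensor_app m A ((1/2) *\<^sub>R v) $ i"
    using A(1,2) prod_list_map_pos[of "\<lambda>j. v $ j / 2"] v
    by (auto simp: tensor_app_def nonneg_tensor_def less_imp_le intro!: sum_nonneg)
  ultimately show ?thesis by simp
qed

lemma vec_max_attained: "\<exists>i. vec_max v = v $ i"
proof -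
  have "vec_max v \<in> range (($) v)" unfolding vec_max_def by (rule Max_in) auto
  then show ?thesis by auto
qed

lemma vec_min_attained: "\<exists>i. vec_min v = v $ i"
proof -
  have "vec_min v \<in> range (($) v)" unfolding vec_min_def by (rule Min_in) auto
  then show ?thesis by auto
qed

lemma le_vec_max: "v $ i \<le> vec_max v"
  unfolding vec_max_def by (rule Max_ge) auto

lemma vec_min_le: "vec_min v \<le> v $ i"
  unfolding vec_min_def by (rule Min_le) auto

section \<open>Comparison and maximum principles for Z-tensors\<close>

text \<open>
  The diagonal monomial depends on the coordinate \<open>i\<close> alone, in which \<open>u\<close> and \<open>v\<close> agree; all other
  monomials have nonpositive coefficients.
\<close>
lemma Z_tensor_term_antimono:
  assumes Z: "Z_tensor m F" and v: "\<And>j. 0 \<le> v $ j" and vu: "\<And>j. v $ j \<le> u $ j"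
    and i: "u $ i = v $ i" and js: "length js = m - 1"
  shows "F (i # js) * prod_list (map (($) u) js) \<le> F (i # js) * prod_list (map (($) v) js)"
proof (cases "js = replicate (m - 1) i")
  case True
  then show ?thesis using i by simp
next
  case False
  then have "F (i # js) \<le> 0" using Z js unfolding Z_tensor_def by blast
  then show ?thesis
    using prod_list_map_mono[of js "($) v" "($) u"] v vu by (auto intro!: mult_left_mono_neg)
qed

lemma Z_tensor_touching_le:
  assumes Z: "Z_tensor m F" and v: "\<And>j. 0 \<le> v $ j" and vu: "\<And>j. v $ j \<le> u $ j"
    and i: "u $ i = v $ i"
  shows "tensor_app m F u $ i \<le> tensor_app m F v $ i"
  unfolding tensor_app_def vec_lambda_beta
  by (rule sum_mono) (use Z_tensor_term_antimono[OF Z v vu i] in simp)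

lemma Z_tensor_touching_less:
  assumes Z: "Z_tensor m F" and v: "\<And>j. 0 < v $ j" and vu: "\<And>j. v $ j \<le> u $ j"
    and i: "u $ i = v $ i" and j: "length js = m - 1" "j \<in> set js" "v $ j < u $ j" "F (i # js) \<noteq> 0"
  shows "tensor_app m F u $ i < tensor_app m F v $ i"
proof -
  have le: "F (i # js) * prod_list (map (($) u) js) \<le> F (i # js) * prod_list (map (($) v) js)"
    if "length js = m - 1" for js
    using that vu v by (intro Z_tensor_term_antimono[OF Z _ vu i]) (auto simp: less_imp_le)
  have "js \<noteq> replicate (m - 1) i" using i j by auto
  then have "F (i # js) < 0" using Z j unfolding Z_tensor_def by (simp add: order_less_le)
  then have "F (i # js) * prod_list (map (($) u) js) < F (i # js) * prod_list (map (($) v) js)"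
    using prod_list_map_strict_mono[of "($) v" "($) u" j js] v vu j
    by (simp add: mult_less_cancel_left_neg)
  then have "(\<Sum>js | length js = m - 1. F (i # js) * prod_list (map (($) u) js))
      < (\<Sum>js | length js = m - 1. F (i # js) * prod_list (map (($) v) js))"
    using le j(1) by (intro sum_strict_mono_ex1[OF finite_index_lists]) auto
  then show ?thesis by (simp add: tensor_app_def)
qed

text \<open>
  Weak irreducibility applied to the set \<open>S\<close> of contact points of \<open>u\<close> and \<open>v\<close> couples some contact
  point to a non-contact point. There \<open>Z_tensor_touching_less\<close> contradicts \<open>F v \<le> F u\<close>, so contact
  at one coordinate spreads to all.
\<close>
lemma Z_tensor_strong_max_principle:
  assumes Z: "Z_tensor m F" and irr: "weakly_irreducible m F"
    and v: "\<And>j. 0 < v $ j" and vu: "\<And>j. v $ j \<le> u $ j" and i: "u $ i = v $ i"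
    and F: "\<And>j. tensor_app m F v $ j \<le> tensor_app m F u $ j"
  shows "u = v"
proof -
  define S where "S = {j. u $ j = v $ j}"
  have "S = UNIV"
  proof (rule ccontr)
    assume "S \<noteq> UNIV"
    moreover have "S \<noteq> {}" using i by (auto simp: S_def)
    ultimately obtain k js j where k: "k \<in> S" "length js = m - 1" "j \<in> set js" "j \<notin> S" "F (k # js) \<noteq> 0"
      using irr unfolding weakly_irreducible_def by blast
    have "v $ j < u $ j" using k(4) vu[of j] by (auto simp: S_def)
    then have "tensor_app m F u $ k < tensor_app m F v $ k"
      using k by (intro Z_tensor_touching_less[OF Z v vu]) (auto simp: S_def)
    with F[of k] show False by simp
  qed
  then show ?thesis by (auto simp: S_def vec_eq_iff)
qed

lemma scale_to_touch:
  fixes u v :: "real ^ 'n::finite"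
  assumes "\<And>j. 0 < u $ j" "\<And>j. 0 < v $ j"
  obtains \<theta> i where "0 < \<theta>" "\<And>j. (\<theta> *\<^sub>R v) $ j \<le> u $ j" "u $ i = (\<theta> *\<^sub>R v) $ i"
proof -
  define \<theta> where "\<theta> = vec_min (vec_quot u v)"
  obtain i where i: "\<theta> = u $ i / v $ i"
    using vec_min_attained[of "vec_quot u v"] by (auto simp: \<theta>_def vec_quot_def)
  have le: "\<theta> \<le> u $ j / v $ j" for j
    using vec_min_le[of "vec_quot u v" j] by (simp add: \<theta>_def vec_quot_def)
  show ?thesis
  proof
    show "0 < \<theta>" using i assms by simp
    show "(\<theta> *\<^sub>R v) $ j \<le> u $ j" for j
      using le[of j] assms(2)[of j] by (simp add: pos_le_divide_eq)
    show "u $ i = (\<theta> *\<^sub>R v) $ i" using i assms(2)[of i] by simp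
  qed
qed

text \<open>
  Scale \<open>v\<close> until it touches \<open>u\<close> from below: at the contact point \<open>F u\<close> is at most a positive multiple
  of \<open>F v\<close>. This separates different eigenvalues below.
\<close>
lemma Z_tensor_no_sign_conflict:
  assumes Z: "Z_tensor m F" and u: "\<And>j. 0 < u $ j" and v: "\<And>j. 0 < v $ j"
    and Fu: "\<And>j. 0 < tensor_app m F u $ j" and Fv: "\<And>j. tensor_app m F v $ j \<le> 0"
  shows False
proof -
  obtain \<theta> i where \<theta>: "0 < \<theta>" "\<And>j. (\<theta> *\<^sub>R v) $ j \<le> u $ j" "u $ i = (\<theta> *\<^sub>R v) $ i"
    using scale_to_touch[OF u v] by blast
  have "tensor_app m F u $ i \<le> tensor_app m F (\<theta> *\<^sub>R v) $ i"
    using \<theta> v by (intro Z_tensor_touching_le[OF Z]) (auto simp: less_imp_le)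
  also have "\<dots> \<le> 0" using \<theta>(1) Fv[of i] by (simp add: tensor_app_scaleR mult_nonneg_nonpos)
  finally show False using Fu[of i] by simp
qed

text \<open>
  Inverse monotonicity on positive vectors. If \<open>\<theta> v\<close> touches \<open>u\<close> from below, then at the contact point
  \<open>F v \<le> F u \<le> \<theta> ^ (m - 1) (F v)\<close>, which forces \<open>\<theta> \<ge> 1\<close>.
\<close>
lemma Z_tensor_comparison:
  assumes Z: "Z_tensor m F" and m: "1 < m" and u: "\<And>j. 0 < u $ j" and v: "\<And>j. 0 < v $ j"
    and Fv: "\<And>j. 0 < tensor_app m F v $ j"
    and F: "\<And>j. tensor_app m F v $ j \<le> tensor_app m F u $ j"
  shows "v $ j \<le> u $ j"
proof -
  obtain \<theta> i where \<theta>: "0 < \<theta>" "\<And>j. (\<theta> *\<^sub>R v) $ j \<le> u $ j" "u $ i = (\<theta> *\<^sub>R v) $ i"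
    using scale_to_touch[OF u v] by blast
  have "tensor_app m F v $ i \<le> tensor_app m F u $ i" by (rule F)
  also have "tensor_app m F u $ i \<le> tensor_app m F (\<theta> *\<^sub>R v) $ i"
    using \<theta> v by (intro Z_tensor_touching_le[OF Z]) (auto simp: less_imp_le)
  also have "\<dots> = \<theta> ^ (m - 1) * tensor_app m F v $ i" by (simp add: tensor_app_scaleR)
  finally have "1 \<le> \<theta> ^ (m - 1)" using Fv[of i] by simp
  then have "1 \<le> \<theta>"
    using \<theta>(1) m power_less_one_iff[of \<theta> "m - 1"] by (force simp: not_less[symmetric])
  then have "v $ j \<le> \<theta> * v $ j" using v[of j] by simp
  also have "\<dots> \<le> u $ j" using \<theta>(2)[of j] by simp
  finally show ?thesis .
qed

lemma Z_tensor_kernel_unique: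
  assumes Z: "Z_tensor m F" and irr: "weakly_irreducible m F"
    and u: "\<And>j. 0 < u $ j" "norm u = 1" and v: "\<And>j. 0 < v $ j" "norm v = 1"
    and F: "tensor_app m F u = 0" "tensor_app m F v = 0"
  shows "u = v"
proof -
  obtain \<theta> i where \<theta>: "0 < \<theta>" "\<And>j. (\<theta> *\<^sub>R v) $ j \<le> u $ j" "u $ i = (\<theta> *\<^sub>R v) $ i"
    using scale_to_touch[OF u(1) v(1)] by blast
  have "u = \<theta> *\<^sub>R v"
    by (rule Z_tensor_strong_max_principle[OF Z irr _ \<theta>(2,3)])
       (use \<theta> v F in \<open>auto simp: tensor_app_scaleR\<close>)
  with u(2) v(2) \<theta>(1) show ?thesis by auto
qed

text \<open>
  Off the diagonal the entries of \<open>\<sigma> M - A\<close> are at most those of \<open>-A\<close>, so every coupling of \<open>A\<close>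
  survives. The witnesses of weak irreducibility are off-diagonal, because they contain an index
  outside the set that contains the leading index.
\<close>
lemma shifted_Z_tensor:
  assumes A: "nonneg_tensor m A" and m: "1 \<le> m" and M: "Z_tensor m M" and \<sigma>: "0 \<le> \<sigma>"
  shows "Z_tensor m (tensor_diff (tensor_scale \<sigma> M) A)"
    and "weakly_irreducible m A \<Longrightarrow> weakly_irreducible m (tensor_diff (tensor_scale \<sigma> M) A)"
proof -
  let ?F = "tensor_diff (tensor_scale \<sigma> M) A"
  have off: "?F (i # js) \<le> - A (i # js)" "0 \<le> A (i # js)"
    if "length js = m - 1" "js \<noteq> replicate (m - 1) i" for i js
  proof -
    have "M (i # js) \<le> 0" using M that by (simp add: Z_tensor_def)
    then show "?F (i # js) \<le> - A (i # js)"
      using \<sigma> by (simp add: tensor_diff_def tensor_scale_def mult_nonneg_nonpos)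
    show "0 \<le> A (i # js)" using A m that by (simp add: nonneg_tensor_def)
  qed
  show "Z_tensor m ?F" unfolding Z_tensor_def using off by force
  assume irr: "weakly_irreducible m A"
  show "weakly_irreducible m ?F"
    unfolding weakly_irreducible_def
  proof (intro allI impI)
    fix S :: "'a set"
    assume "S \<noteq> {} \<and> S \<noteq> UNIV"
    then obtain i js j where i: "i \<in> S" "length js = m - 1" "j \<in> set js" "j \<notin> S" "A (i # js) \<noteq> 0"
      using irr unfolding weakly_irreducible_def by blast
    moreover have "js \<noteq> replicate (m - 1) i" using i by auto
    ultimately have "?F (i # js) \<noteq> 0" using off[of js i] by auto
    with i show "\<exists>i\<in>S. \<exists>js. length js = m - 1 \<and> (\<exists>j\<in>set js. j \<notin> S) \<and> ?F (i # js) \<noteq> 0"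
      by blast
  qed
qed

section \<open>The Noda step\<close>

text \<open>
  With \<open>F = \<sigma> M - A\<close> the bound on \<open>A x\<close> reads \<open>F x \<ge> (\<sigma> - s) (M x)\<close>, and the right-hand side is
  \<open>F v\<close> for a suitable multiple \<open>v\<close> of \<open>x'\<close>. Comparison gives \<open>x \<ge> v\<close>, hence \<open>A x \<ge> A v\<close>; adding
  the two inequalities gives \<open>M x \<ge> M v\<close>, although \<open>M\<close> itself is not monotone. Inserting this
  into the equation of the step yields the bound for \<open>x'\<close>. If \<open>x\<close> is not an eigenvector, then \<open>x \<noteq> v\<close>,
  the strong maximum principle gives \<open>x > v\<close> in every coordinate, and all inequalities become strict.
\<close>
lemma noda_step:
  fixes A M :: "'n::finite tensor"
  assumes A: "nonneg_tensor m A" "weakly_irreducible m A" and M: "Z_tensor m M"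
    and m: "1 < m" and n: "1 < CARD('n)"
    and s: "0 \<le> s" "s < \<sigma>" and d: "0 < d"
    and x: "\<And>i. 0 < x $ i" and x': "\<And>i. 0 < x' $ i"
    and Mx: "\<And>i. 0 < tensor_app m M x $ i"
    and Ax: "\<And>i. tensor_app m A x $ i \<le> s * tensor_app m M x $ i"
    and step: "\<sigma> *\<^sub>R tensor_app m M x' - tensor_app m A x' = d *\<^sub>R tensor_app m M x"
  shows "tensor_app m A x' $ i \<le> s * tensor_app m M x' $ i"
    and "tensor_app m A x \<noteq> s *\<^sub>R tensor_app m M x \<Longrightarrow>
           tensor_app m A x' $ i < s * tensor_app m M x' $ i"
proof -
  define F where "F = tensor_diff (tensor_scale \<sigma> M) A"
  have Fapp: "tensor_app m F z = \<sigma> *\<^sub>R tensor_app m M z - tensor_app m A z" for z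
    by (simp add: F_def tensor_app_diff tensor_app_scale)
  have ZF: "Z_tensor m F" and irrF: "weakly_irreducible m F"
    unfolding F_def using shifted_Z_tensor[OF A(1) _ M, of \<sigma>] A(2) m s by auto
  \<comment> \<open>Chosen by homogeneity so that \<open>F (\<gamma> x') = (\<sigma> - s) (M x)\<close>.\<close>
  define \<gamma> where "\<gamma> = root (m - 1) ((\<sigma> - s) / d)"
  have \<gamma>: "0 < \<gamma>" "\<gamma> ^ (m - 1) = (\<sigma> - s) / d"
    using s d m by (auto simp: \<gamma>_def)
  define v where "v = \<gamma> *\<^sub>R x'"
  have v: "0 < v $ j" for j using \<gamma> x' by (simp add: v_def)
  have Fv: "tensor_app m F v = (\<sigma> - s) *\<^sub>R tensor_app m M x"
    unfolding v_def tensor_app_scaleR \<gamma> Fapp step using d by simp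
  have Fx: "tensor_app m F x $ j = \<sigma> * tensor_app m M x $ j - tensor_app m A x $ j" for j
    by (simp add: Fapp)
  have Fvx: "tensor_app m F v $ j \<le> tensor_app m F x $ j" for j
    unfolding Fv Fx using Ax[of j] by (simp add: algebra_simps)
  have vx: "v $ j \<le> x $ j" for j
    by (rule Z_tensor_comparison[OF ZF m x v _ Fvx]) (use Fv s Mx in auto)
  have st: "(\<sigma> - s) * tensor_app m M x' $ i = d * (\<gamma> ^ (m - 1) * tensor_app m M x' $ i)"
    using \<gamma> d by simp
  also have "\<gamma> ^ (m - 1) * tensor_app m M x' $ i = tensor_app m M v $ i"
    by (simp add: v_def tensor_app_scaleR)
  finally have Mv: "(\<sigma> - s) * tensor_app m M x' $ i = d * tensor_app m M v $ i" .
  have step_i: "tensor_app m A x' $ i = \<sigma> * tensor_app m M x' $ i - d * tensor_app m M x $ i"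
    using arg_cong[OF step, of "\<lambda>z. z $ i"] by simp
  have dec: "\<sigma> * tensor_app m M z $ i = tensor_app m F z $ i + tensor_app m A z $ i" for z
    by (simp add: Fapp)
  have "tensor_app m A v $ i \<le> tensor_app m A x $ i"
    using m vx v by (intro tensor_app_mono[OF A(1)]) (auto simp: less_imp_le)
  then have "\<sigma> * tensor_app m M v $ i \<le> \<sigma> * tensor_app m M x $ i"
    unfolding dec using Fvx[of i] by simp
  then have "d * tensor_app m M v $ i \<le> d * tensor_app m M x $ i" using s d by simp
  then show "tensor_app m A x' $ i \<le> s * tensor_app m M x' $ i"
    using Mv step_i by (simp add: algebra_simps)
  assume ne: "tensor_app m A x \<noteq> s *\<^sub>R tensor_app m M x"
  have "v $ j < x $ j" for j
  proof (rule ccontr)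
    assume "\<not> v $ j < x $ j"
    with vx[of j] have "x $ j = v $ j" by simp
    then have "x = v" by (rule Z_tensor_strong_max_principle[OF ZF irrF v vx _ Fvx])
    then have "tensor_app m F x = (\<sigma> - s) *\<^sub>R tensor_app m M x" using Fv by simp
    then have "tensor_app m A x = s *\<^sub>R tensor_app m M x" by (simp add: Fapp algebra_simps)
    with ne show False by simp
  qed
  then have "tensor_app m A v $ i < tensor_app m A x $ i"
    using m v by (intro tensor_app_strict_mono[OF A(1) _ A(2) n]) auto
  then have "\<sigma> * tensor_app m M v $ i < \<sigma> * tensor_app m M x $ i"
    unfolding dec using Fvx[of i] by simp
  then have "d * tensor_app m M v $ i < d * tensor_app m M x $ i" using s d by simp
  then show "tensor_app m A x' $ i < s * tensor_app m M x' $ i"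
    using Mv step_i by (simp add: algebra_simps)
qed

section \<open>A Harnack inequality\<close>

text \<open>
  Suppose \<open>A x \<le> C x ^ (m - 1)\<close> and let \<open>x\<^sub>l\<close> be the smallest coordinate. A nonzero entry in row \<open>i\<close>
  that involves the index \<open>j\<close> gives \<open>\<alpha> x\<^sub>j x\<^sub>l ^ (m - 2) \<le> C x\<^sub>i ^ (m - 1)\<close>, with \<open>\<alpha>\<close> a positive
  lower bound for the nonzero entries. So if \<open>x\<^sub>i\<close> is bounded by a multiple of \<open>x\<^sub>l\<close>, then so is \<open>x\<^sub>j\<close>. Weak irreducibility
  supplies such a link out of every proper set of controlled coordinates, and the controlled set grows
  by one coordinate at a time until it is everything. A limit argument with nonnegative
  vectors would not do: weak irreducibility allows eigenvectors with zero coordinates.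
\<close>
lemma weakly_irreducible_harnack:
  fixes A :: "'n::finite tensor"
  assumes A: "nonneg_tensor m A" "weakly_irreducible m A" and m: "1 < m" and C: "0 \<le> C"
  obtains K where "0 < K"
    and "\<And>x i j. \<lbrakk>\<And>i. 0 < x $ i; \<And>i. tensor_app m A x $ i \<le> C * (x $ i) ^ (m - 1)\<rbrakk>
           \<Longrightarrow> x $ i \<le> K * x $ j"
proof -
  \<comment> \<open>The inserted 1 keeps the set nonempty, so that the minimum is meaningful for every \<open>A\<close>.\<close>
  define V where "V = insert 1 (A ` {is. length is = m \<and> A is \<noteq> 0})"
  define \<alpha> where "\<alpha> = Min V"
  have fin: "finite {is. length is = m \<and> A is \<noteq> 0}"
    by (rule finite_subset[OF _ finite_index_lists[of m]]) auto
  have finV: "finite V" unfolding V_def finite_insert by (rule finite_imageI[OF fin])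
  have Vpos: "0 < a" if "a \<in> V" for a
    using that A(1) unfolding V_def nonneg_tensor_def by (force simp: order_less_le)
  have "V \<noteq> {}" by (simp add: V_def)
  then have \<alpha>: "0 < \<alpha>" unfolding \<alpha>_def by (intro Vpos Min_in[OF finV])
  have \<alpha>_le: "\<alpha> \<le> A is" if "length is = m" "A is \<noteq> 0" for "is"
    unfolding \<alpha>_def by (rule Min_le[OF finV]) (use that in \<open>auto simp: V_def\<close>)
  define adm where "adm x \<longleftrightarrow> (\<forall>i. 0 < x $ i) \<and> (\<forall>i. tensor_app m A x $ i \<le> C * (x $ i) ^ (m - 1))"
    for x :: "real ^ 'n"
  have link: "x $ j * (x $ l) ^ (m - 2) \<le> C / \<alpha> * (x $ i) ^ (m - 1)"
    if x: "adm x" and l: "\<And>k. x $ l \<le> x $ k"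
      and j: "length js = m - 1" "j \<in> set js" "A (i # js) \<noteq> 0"
    for x :: "real ^ 'n" and i j js l
  proof -
    have pos: "0 < x $ k" for k using x by (simp add: adm_def)
    obtain as bs where js: "js = as @ j # bs" using split_list[OF j(2)] by blast
    have "prod_list (map (\<lambda>k. x $ l) ks) \<le> prod_list (map (($) x) ks)" for ks
      using prod_list_map_mono[of ks "\<lambda>k. x $ l" "($) x"] l pos[of l] by auto
    then have "(x $ l) ^ length ks \<le> prod_list (map (($) x) ks)" for ks
      by (simp add: map_replicate_const)
    then have "(x $ l) ^ length as * (x $ l) ^ length bs
        \<le> prod_list (map (($) x) as) * prod_list (map (($) x) bs)"
      using pos[of l] prod_list_map_pos[of "($) x"] pos by (intro mult_mono) (auto simp: less_imp_le)
    moreover have "length as + length bs = m - 2" using j(1) js by auto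
    ultimately have "x $ j * (x $ l) ^ (m - 2) \<le> prod_list (map (($) x) js)"
      using pos[of j] by (simp add: js power_add[symmetric] algebra_simps)
    then have "\<alpha> * (x $ j * (x $ l) ^ (m - 2)) \<le> A (i # js) * prod_list (map (($) x) js)"
      using \<alpha> \<alpha>_le[of "i # js"] j m pos[of j] pos[of l] by (intro mult_mono) auto
    also have "\<dots> \<le> tensor_app m A x $ i"
    proof -
      have "0 \<le> A (i # ks) * prod_list (map (($) x) ks)" if "length ks = m - 1" for ks
        using A(1) m that prod_list_map_pos[of "($) x" ks] pos
        by (auto simp: nonneg_tensor_def less_imp_le)
      then show ?thesis
        unfolding tensor_app_def using j(1)
        by (auto intro!: member_le_sum[of _ _ "\<lambda>ks. A (i # ks) * prod_list (map (($) x) ks)"]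
            finite_index_lists)
    qed
    also have "\<dots> \<le> C * (x $ i) ^ (m - 1)" using x by (simp add: adm_def)
    finally show ?thesis using \<alpha> by (simp add: field_simps)
  qed
  \<comment> \<open>The constant \<open>K\<close> may depend on \<open>p\<close>, but not on \<open>x\<close>; only the controlled set \<open>S\<close> depends on \<open>x\<close>.
    The condition on \<open>l\<close> says that it is a position of the smallest coordinate.\<close>
  have "\<exists>K>0. \<forall>x. adm x \<longrightarrow> (\<exists>S. p \<le> card S \<and> (\<forall>i\<in>S. \<forall>l. (\<forall>k. x $ l \<le> x $ k) \<longrightarrow> x $ i \<le> K * x $ l))"
    if "p \<le> CARD('n)" for p
    using that
  proof (induction p)
    case 0
    then show ?case by (intro exI[of _ 1]) (auto intro: exI[of _ "{}"])
  next
    case (Suc p)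
    then obtain K where K: "0 < K" and KS: "\<And>x. adm x \<Longrightarrow>
        \<exists>S. p \<le> card S \<and> (\<forall>i\<in>S. \<forall>l. (\<forall>k. x $ l \<le> x $ k) \<longrightarrow> x $ i \<le> K * x $ l)"
      by auto
    define K' where "K' = max (max K 1) (C / \<alpha> * K ^ (m - 1))"
    have K': "0 < K'" "1 \<le> K'" "K \<le> K'" "C / \<alpha> * K ^ (m - 1) \<le> K'" by (auto simp: K'_def)
    have "\<exists>S. Suc p \<le> card S \<and> (\<forall>i\<in>S. \<forall>l. (\<forall>k. x $ l \<le> x $ k) \<longrightarrow> x $ i \<le> K' * x $ l)"
      if x: "adm x" for x
    proof -
      obtain S where S: "p \<le> card S" "\<And>i l. i \<in> S \<Longrightarrow> (\<forall>k. x $ l \<le> x $ k) \<Longrightarrow> x $ i \<le> K * x $ l"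
        using KS[OF x] by blast
      have pos: "0 < x $ k" for k using x by (simp add: adm_def)
      have S': "x $ i \<le> K' * x $ l" if "i \<in> S" "\<forall>k. x $ l \<le> x $ k" for i l
        by (rule order_trans[OF S(2)[OF that]]) (use K'(3) pos[of l] in \<open>simp add: mult_right_mono\<close>)
      consider "S = UNIV" | "S = {}" | "S \<noteq> {}" "S \<noteq> UNIV" by blast
      then obtain j where j: "S = UNIV \<or> j \<notin> S" "\<And>l. (\<forall>k. x $ l \<le> x $ k) \<Longrightarrow> x $ j \<le> K' * x $ l"
      proof cases
        case 1
        then show ?thesis using that[of undefined] S' by auto
      next
        case 2
        obtain j where "vec_min x = x $ j" using vec_min_attained by blast
        then have "x $ j \<le> x $ l" for l using vec_min_le[of x l] by simp
        moreover have "x $ l \<le> K' * x $ l" for l using K'(2) pos[of l] by simp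
        ultimately show ?thesis using that[of j] 2 by (metis empty_iff order_trans)
      next
        case 3
        then obtain i js j where i: "i \<in> S" "length js = m - 1" "j \<in> set js" "j \<notin> S" "A (i # js) \<noteq> 0"
          using A(2) unfolding weakly_irreducible_def by blast
        have "x $ j \<le> K' * x $ l" if l: "\<forall>k. x $ l \<le> x $ k" for l
        proof -
          have m2: "m - 1 = Suc (m - 2)" using m by simp
          have "x $ j * (x $ l) ^ (m - 2) \<le> C / \<alpha> * (x $ i) ^ (m - 1)"
            using link[OF x _ i(2,3,5)] l by blast
          also have "\<dots> \<le> C / \<alpha> * (K * x $ l) ^ (m - 1)"
            using S(2)[OF i(1) l] pos[of i] C \<alpha> by (intro mult_left_mono power_mono) auto
          also have "\<dots> = (C / \<alpha> * K ^ (m - 1)) * x $ l * (x $ l) ^ (m - 2)"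
            unfolding power_mult_distrib m2 power_Suc by (simp add: mult_ac)
          finally have "x $ j \<le> (C / \<alpha> * K ^ (m - 1)) * x $ l"
            by (rule mult_right_le_imp_le) (use pos[of l] in simp)
          also have "\<dots> \<le> K' * x $ l" using K'(4) pos[of l] by (intro mult_right_mono) auto
          finally show ?thesis .
        qed
        then show ?thesis using that[of j] i(4) by blast
      qed
      show ?thesis
      proof (cases "S = UNIV")
        case True
        then show ?thesis using Suc.prems S' by (intro exI[of _ S]) auto
      next
        case False
        then have "j \<notin> S" using j(1) by simp
        then have "Suc p \<le> card (insert j S)" using S(1) by simp
        then show ?thesis using S' j(2) by (intro exI[of _ "insert j S"]) auto
      qed
    qed
    then show ?case using K'(1) by blast
  qed
  from this[OF order_refl] obtain K where K: "0 < K" and KS: "\<And>x. adm x \<Longrightarrow>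
      \<exists>S. CARD('n) \<le> card S \<and> (\<forall>i\<in>S. \<forall>l. (\<forall>k. x $ l \<le> x $ k) \<longrightarrow> x $ i \<le> K * x $ l)"
    by blast
  show ?thesis
  proof (rule that[OF K])
    fix x :: "real ^ 'n" and i j
    assume "\<And>i. 0 < x $ i" "\<And>i. tensor_app m A x $ i \<le> C * (x $ i) ^ (m - 1)"
    then have "adm x" by (simp add: adm_def)
    then obtain S where S: "CARD('n) \<le> card S"
        "\<And>i l. i \<in> S \<Longrightarrow> (\<forall>k. x $ l \<le> x $ k) \<Longrightarrow> x $ i \<le> K * x $ l"
      using KS by blast
    have "S = UNIV" using S(1) by (intro card_seteq) auto
    obtain l where "vec_min x = x $ l" using vec_min_attained by blast
    then have lmin: "x $ l \<le> x $ k" for k using vec_min_le[of x k] by simp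
    have "x $ i \<le> K * x $ l" using S(2) lmin \<open>S = UNIV\<close> by blast
    also have "\<dots> \<le> K * x $ j" using K lmin by simp
    finally show "x $ i \<le> K * x $ j" .
  qed
qed

text \<open>
  A positive \<open>x\<close> touches \<open>x\<^sub>i e\<^sub>i\<close> from above at \<open>i\<close>, so only the diagonal entry of the row matters.
  This turns \<open>A x \<le> s (M x)\<close> into the hypothesis of the Harnack inequality.
\<close>
lemma Z_tensor_diagonal_bound:
  fixes M :: "'n::finite tensor"
  assumes M: "Z_tensor m M"
  obtains C where "0 \<le> C"
    and "\<And>x i. (\<And>j. 0 < x $ j) \<Longrightarrow> tensor_app m M x $ i \<le> C * (x $ i) ^ (m - 1)"
proof
  define C where "C = (\<Sum>i\<in>UNIV. \<bar>tensor_app m M (axis i 1) $ i\<bar>)"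
  show "0 \<le> C" by (simp add: C_def sum_nonneg)
  fix x :: "real ^ 'n" and i
  assume x: "\<And>j. 0 < x $ j"
  have "tensor_app m M x $ i \<le> tensor_app m M (x $ i *\<^sub>R axis i 1) $ i"
    using x by (intro Z_tensor_touching_le[OF M]) (auto simp: axis_def less_imp_le)
  also have "\<dots> = (x $ i) ^ (m - 1) * tensor_app m M (axis i 1) $ i"
    by (simp add: tensor_app_scaleR)
  also have "\<dots> \<le> (x $ i) ^ (m - 1) * C"
  proof (rule mult_left_mono)
    have "\<bar>tensor_app m M (axis i 1) $ i\<bar> \<le> C"
      unfolding C_def by (rule member_le_sum) auto
    then show "tensor_app m M (axis i 1) $ i \<le> C" by simp
  qed (use x[of i] in simp)
  finally show "tensor_app m M x $ i \<le> C * (x $ i) ^ (m - 1)" by (simp add: mult.commute)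
qed

section \<open>Convergence of Noda sequences\<close>

lemma tendsto_if_unique_subsequential_limit:
  fixes x :: "nat \<Rightarrow> 'a::metric_space"
  assumes K: "compact K" "\<And>k. x k \<in> K"
    and lim: "\<And>r z. \<lbrakk>strict_mono r; (x \<circ> r) \<longlonglongrightarrow> z\<rbrakk> \<Longrightarrow> z = l"
  shows "x \<longlonglongrightarrow> l"
proof (rule ccontr)
  assume "\<not> x \<longlonglongrightarrow> l"
  then obtain e where e: "0 < e" "\<not> (\<forall>\<^sub>F k in sequentially. dist (x k) l < e)"
    unfolding tendsto_iff by blast
  then have "infinite {k. e \<le> dist (x k) l}"
    by (simp add: not_eventually not_less frequently_cofinite flip: cofinite_eq_sequentially)
  then obtain r where r: "strict_mono (r :: nat \<Rightarrow> nat)" "\<And>n. r n \<in> {k. e \<le> dist (x k) l}"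
    using infinite_enumerate by blast
  obtain z q where q: "strict_mono (q :: nat \<Rightarrow> nat)" "((x \<circ> r) \<circ> q) \<longlonglongrightarrow> z"
    using K unfolding compact_def by (metis comp_apply)
  then have "z = l" using lim[of "r \<circ> q" z] r(1) by (simp add: strict_mono_o comp_assoc)
  then have "\<forall>\<^sub>F n in sequentially. dist (((x \<circ> r) \<circ> q) n) l < e"
    using q(2) e(1) by (auto simp: tendsto_iff)
  then obtain n where "dist (x (r (q n))) l < e" by (auto simp: eventually_sequentially)
  with r(2)[of "q n"] show False by simp
qed

text \<open>
  The shift \<open>\<sigma> = (1 + \<epsilon>) s / (1 - \<epsilon> s)\<close> is \<open>\<rho> / (1 - \<rho>)\<close> for \<open>\<rho> = (1 + \<epsilon>) s / (1 + s)\<close>. It is a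
  continuous function of \<open>s\<close> and exceeds \<open>s\<close>, so the Noda equation passes to the limit with a shift that
  still exceeds the limit of \<open>s\<close>; this gap is what lets \<open>noda_step\<close> apply to limit points.
\<close>
lemma noda_converges:
  fixes A M :: "'n::finite tensor"
  assumes A: "nonneg_tensor m A" "weakly_irreducible m A" and M: "Z_tensor m M"
    and m: "1 < m" and n: "1 < CARD('n)" and \<epsilon>: "0 < \<epsilon>"
    and x: "\<And>k i. 0 < x k $ i" "\<And>k. norm (x k) = 1"
    and Mx: "\<And>k i. 0 < tensor_app m M (x k) $ i"
    and s_ge: "\<And>k i. tensor_app m A (x k) $ i \<le> s k * tensor_app m M (x k) $ i"
    and s_attained: "\<And>k. \<exists>i. tensor_app m A (x k) $ i = s k * tensor_app m M (x k) $ i"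
    and s: "\<And>k. 0 < s k" "decseq s" "\<epsilon> * s 0 < 1"
    and \<sigma>: "\<And>k. \<sigma> k = (1 + \<epsilon>) * s k / (1 - \<epsilon> * s k)"
    and d: "\<And>k. 0 < d k"
    and step: "\<And>k. \<sigma> k *\<^sub>R tensor_app m M (x (Suc k)) - tensor_app m A (x (Suc k))
                 = d k *\<^sub>R tensor_app m M (x k)"
  obtains l z where "0 < l" "s \<longlonglongrightarrow> l" "x \<longlonglongrightarrow> z" "\<And>i. 0 < z $ i"
    and "tensor_app m A z = l *\<^sub>R tensor_app m M z"
proof -
  obtain C where C: "0 \<le> C"
    "\<And>x i. (\<And>j. 0 < x $ j) \<Longrightarrow> tensor_app m M x $ i \<le> C * (x $ i) ^ (m - 1)"
    using Z_tensor_diagonal_bound[OF M] by blast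
  have "0 \<le> s 0 * C" using s(1)[of 0] C(1) by simp
  then obtain K where K: "0 < K" "\<And>x i j. \<lbrakk>\<And>i. 0 < x $ i;
      \<And>i. tensor_app m A x $ i \<le> (s 0 * C) * (x $ i) ^ (m - 1)\<rbrakk> \<Longrightarrow> x $ i \<le> K * x $ j"
    using weakly_irreducible_harnack[OF A m] by blast
  have s_le: "s k \<le> s 0" for k using s(2) by (simp add: decseqD)
  have ratio: "x k $ i \<le> K * x k $ j" for k i j
  proof (rule K(2)[OF x(1)])
    fix i
    have "tensor_app m A (x k) $ i \<le> s 0 * tensor_app m M (x k) $ i"
      by (rule order_trans[OF s_ge]) (use s_le[of k] Mx[of k i] in \<open>simp add: mult_right_mono\<close>)
    also have "\<dots> \<le> s 0 * (C * (x k $ i) ^ (m - 1))"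
      using s(1)[of 0] C(2)[of "x k" i] x(1) by (intro mult_left_mono) auto
    finally show "tensor_app m A (x k) $ i \<le> (s 0 * C) * (x k $ i) ^ (m - 1)" by simp
  qed
  \<comment> \<open>A unit vector has \<open>\<ell>\<^sup>1\<close> norm at least 1, and all its coordinates are comparable to each other.\<close>
  define \<delta> where "\<delta> = 1 / (real CARD('n) * K)"
  have \<delta>: "0 < \<delta>" using K(1) by (simp add: \<delta>_def)
  have x_ge: "\<delta> \<le> x k $ j" for k j
  proof -
    have "1 \<le> (\<Sum>i\<in>UNIV. \<bar>x k $ i\<bar>)" using norm_le_l1_cart[of "x k"] x(2) by simp
    also have "\<dots> \<le> (\<Sum>i\<in>(UNIV :: 'n set). K * x k $ j)"
      using ratio[of k _ j] x(1)[of k] by (intro sum_mono) (simp add: abs_of_pos)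
    also have "\<dots> = real CARD('n) * K * x k $ j" by simp
    finally show ?thesis using K(1) unfolding \<delta>_def by (subst pos_divide_le_eq) (auto simp: mult_ac)
  qed
  define Q where "Q = sphere (0 :: real ^ 'n) 1"
  have Q: "compact Q" "\<And>k. x k \<in> Q" using x(2) by (auto simp: Q_def)
  obtain l where l: "s \<longlonglongrightarrow> l" "\<And>k. l \<le> s k"
    using decseq_convergent[OF s(2), of 0] s(1) by (auto simp: less_imp_le)
  have l0: "0 \<le> l" by (rule LIMSEQ_le_const[OF l(1)]) (use s(1) in \<open>auto simp: less_imp_le\<close>)
  have tapp: "(\<lambda>n. tensor_app m T (f n) $ i) \<longlonglongrightarrow> tensor_app m T z $ i"
    if "f \<longlonglongrightarrow> z" for T f z i
    by (intro tendsto_vec_nth isCont_tendsto_compose[OF continuous_tensor_app that])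
  \<comment> \<open>Stated for any index sequence tending to infinity, since it is used both for a subsequence and
    for the sequence of its successors.\<close>
  have limit_facts: "(\<forall>i. 0 < z $ i) \<and> norm z = 1 \<and> 0 < l \<and> (\<forall>i. 0 < tensor_app m M z $ i)
      \<and> (\<forall>i. tensor_app m A z $ i \<le> l * tensor_app m M z $ i)"
    if r: "filterlim r at_top sequentially" and z: "(\<lambda>n. x (r n)) \<longlonglongrightarrow> z" for r z
  proof -
    have "\<delta> \<le> z $ i" for i
      by (rule LIMSEQ_le_const[OF tendsto_vec_nth[OF z]]) (use x_ge in auto)
    then have zpos: "0 < z $ i" for i using \<delta> by (meson less_le_trans)
    have nz: "norm z = 1"
      using tendsto_norm[OF z] x(2) by (simp add: LIMSEQ_const_iff)
    have Az: "0 < tensor_app m A z $ i" for i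
      using m by (intro tensor_app_pos[OF A(1) _ A(2) n zpos]) auto
    have "(\<lambda>n. s (r n)) \<longlonglongrightarrow> l" using filterlim_compose[OF l(1) r] .
    then have le: "tensor_app m A z $ i \<le> l * tensor_app m M z $ i" for i
      by (intro LIMSEQ_le[OF tapp[OF z] tendsto_mult[OF _ tapp[OF z]]]) (use s_ge in auto)
    have "0 < l * tensor_app m M z $ i" for i using le[of i] Az[of i] by simp
    then have "0 < l" "0 < tensor_app m M z $ i" for i using l0 by (auto simp: zero_less_mult_iff)
    then show ?thesis using zpos nz le by blast
  qed
  have eig: "tensor_app m A z = l *\<^sub>R tensor_app m M z"
    if r: "strict_mono r" and z: "(x \<circ> r) \<longlonglongrightarrow> z" for r z
  proof (rule ccontr)
    assume ne: "tensor_app m A z \<noteq> l *\<^sub>R tensor_app m M z"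
    have "\<forall>n. (x \<circ> Suc \<circ> r) n \<in> Q" using Q(2) by simp
    then obtain z' q where q: "strict_mono (q :: nat \<Rightarrow> nat)" "((x \<circ> Suc \<circ> r) \<circ> q) \<longlonglongrightarrow> z'"
      using Q(1) unfolding compact_def by blast
    define p where "p = r \<circ> q"
    have p: "strict_mono p" unfolding p_def using r q(1) by (rule strict_mono_o)
    have pinf: "filterlim p at_top sequentially" using p by (rule filterlim_subseq)
    have Spinf: "filterlim (\<lambda>n. Suc (p n)) at_top sequentially"
      using p by (intro filterlim_subseq) (simp add: strict_mono_def)
    have zp: "(\<lambda>n. x (p n)) \<longlonglongrightarrow> z"
      using LIMSEQ_subseq_LIMSEQ[OF z q(1)] by (simp add: p_def comp_def)
    have zp': "(\<lambda>n. x (Suc (p n))) \<longlonglongrightarrow> z'" using q(2) by (simp add: p_def comp_def)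
    have Z: "\<And>i. 0 < z $ i" "0 < l" "\<And>i. 0 < tensor_app m M z $ i"
        "\<And>i. tensor_app m A z $ i \<le> l * tensor_app m M z $ i"
      using limit_facts[OF pinf zp] by auto
    have Z': "\<And>i. 0 < z' $ i" "\<And>i. 0 < tensor_app m M z' $ i"
        "\<And>i. tensor_app m A z' $ i \<le> l * tensor_app m M z' $ i"
      using limit_facts[OF Spinf zp'] by auto
    have \<epsilon>l: "\<epsilon> * l < 1" using mult_left_mono[OF l(2)[of 0] less_imp_le[OF \<epsilon>]] s(3) by linarith
    define \<sigma>' where "\<sigma>' = (1 + \<epsilon>) * l / (1 - \<epsilon> * l)"
    have "\<sigma> \<longlonglongrightarrow> \<sigma>'"
      unfolding \<sigma> \<sigma>'_def using \<epsilon>l by (intro tendsto_intros l(1)) auto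
    then have \<sigma>p: "(\<lambda>n. \<sigma> (p n)) \<longlonglongrightarrow> \<sigma>'" using pinf by (rule filterlim_compose)
    have "l * (1 - \<epsilon> * l) < (1 + \<epsilon>) * l"
      using Z(2) \<epsilon> by (simp add: algebra_simps add_pos_pos)
    then have \<sigma>': "l < \<sigma>'" unfolding \<sigma>'_def using \<epsilon>l by (simp add: pos_less_divide_eq)
    \<comment> \<open>Each coordinate of the step equation determines \<open>d\<close>, so \<open>d\<close> converges along the subsequence;
      the limit \<open>D i\<close> is the same for every \<open>i\<close>.\<close>
    define D where "D i = (\<sigma>' * tensor_app m M z' $ i - tensor_app m A z' $ i) / tensor_app m M z $ i" for i
    have D: "(\<lambda>n. d (p n)) \<longlonglongrightarrow> D i" for i
    proof -
      have "d (p n) = (\<sigma> (p n) * tensor_app m M (x (Suc (p n))) $ i - tensor_app m A (x (Suc (p n))) $ i)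
             / tensor_app m M (x (p n)) $ i" for n
        using arg_cong[OF step[of "p n"], of "\<lambda>v. v $ i"] Mx[of "p n" i]
        by (simp add: field_simps)
      then show ?thesis
        unfolding D_def using Z(3)[of i]
        by (auto intro!: tendsto_intros tapp zp zp' \<sigma>p simp: less_imp_neq[symmetric])
    qed
    have Dpos: "0 < D i" for i
    proof -
      have "l * tensor_app m M z' $ i < \<sigma>' * tensor_app m M z' $ i"
        using \<sigma>' Z'(2)[of i] by simp
      then show ?thesis unfolding D_def using Z'(3)[of i] Z(3)[of i] by simp
    qed
    have Deq: "D i = D j" for i j using D LIMSEQ_unique by blast
    have "\<sigma>' *\<^sub>R tensor_app m M z' - tensor_app m A z' = D undefined *\<^sub>R tensor_app m M z"
    proof (rule vec_eq_iff[THEN iffD2], rule allI)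
      fix i
      show "(\<sigma>' *\<^sub>R tensor_app m M z' - tensor_app m A z') $ i = (D undefined *\<^sub>R tensor_app m M z) $ i"
        using Z(3)[of i] unfolding Deq[of undefined i] by (simp add: D_def)
    qed
    then have less: "tensor_app m A z' $ i < l * tensor_app m M z' $ i" for i
      using noda_step(2)[OF A M m n l0 \<sigma>' Dpos Z(1) Z'(1) Z(3,4) _ ne] by blast
    have "\<forall>\<^sub>F n in sequentially.
        tensor_app m A (x (Suc (p n))) $ i < l * tensor_app m M (x (Suc (p n))) $ i" for i
    proof -
      have "(\<lambda>n. l * tensor_app m M (x (Suc (p n))) $ i - tensor_app m A (x (Suc (p n))) $ i)
          \<longlonglongrightarrow> l * tensor_app m M z' $ i - tensor_app m A z' $ i"
        by (intro tendsto_intros tapp zp')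
      from order_tendstoD(1)[OF this, of 0] show ?thesis using less[of i] by simp
    qed
    then have "\<forall>\<^sub>F n in sequentially. \<forall>i.
        tensor_app m A (x (Suc (p n))) $ i < l * tensor_app m M (x (Suc (p n))) $ i"
      by (simp add: eventually_all_finite)
    \<comment> \<open>The strict inequality at \<open>z'\<close> has reached an iterate, whose maximal ratio is then below \<open>l\<close>.\<close>
    then obtain k where k: "\<And>i. tensor_app m A (x k) $ i < l * tensor_app m M (x k) $ i"
      by (auto simp: eventually_sequentially)
    obtain i where "tensor_app m A (x k) $ i = s k * tensor_app m M (x k) $ i"
      using s_attained by blast
    then have "s k < l" using k[of i] Mx[of k i] by simp
    with l(2)[of k] show False by simp
  qed
  obtain z r where r: "strict_mono (r :: nat \<Rightarrow> nat)" "(x \<circ> r) \<longlonglongrightarrow> z"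
    using Q unfolding compact_def by blast
  have sub: "(\<forall>i. 0 < w $ i) \<and> norm w = 1 \<and> 0 < l \<and> tensor_app m A w = l *\<^sub>R tensor_app m M w"
    if "strict_mono q" "(x \<circ> q) \<longlonglongrightarrow> w" for q w
    using limit_facts[OF filterlim_subseq[OF that(1)], of w] eig[OF that] that(2) by (auto simp: comp_def)
  have "x \<longlonglongrightarrow> z"
  proof (rule tendsto_if_unique_subsequential_limit[OF Q])
    fix q w
    assume q: "strict_mono (q :: nat \<Rightarrow> nat)" "(x \<circ> q) \<longlonglongrightarrow> w"
    have F: "Z_tensor m (tensor_diff (tensor_scale l M) A)"
        "weakly_irreducible m (tensor_diff (tensor_scale l M) A)"
      using shifted_Z_tensor[OF A(1) _ M l0] A(2) m by auto
    show "w = z"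
      by (rule Z_tensor_kernel_unique[OF F])
         (use sub[OF q] sub[OF r] in \<open>auto simp: tensor_app_diff tensor_app_scale\<close>)
  qed
  with sub[OF r] l(1) show ?thesis using that[of l z] by blast
qed

section \<open>Runs of the iteration\<close>

text \<open>
  Since \<open>\<rho> B - A = \<rho> M - (1 - \<rho>) A\<close>, the equation for \<open>y\<close> reads \<open>\<rho> (M y) = M x + (1 - \<rho>) (A y)\<close>.
  This makes \<open>M y\<close> positive, and dividing by \<open>M y\<close> turns the minimum that defines \<open>\<tau>\<close> into the maximum that
  defines \<open>s\<close>: \<open>\<tau> = \<rho> - (1 - \<rho>) s\<close>. Hence the bracket in the update rule for \<open>\<rho>\<close> is exactly
  \<open>rhobar = s / (1 + s)\<close>. Dividing by \<open>1 - \<rho>\<close> instead, and normalizing, gives the Noda step.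
\<close>
lemma mtni_step:
  fixes A B :: "'n::finite tensor"
  defines "M \<equiv> tensor_diff B A"
  assumes A: "nonneg_tensor m A" "weakly_irreducible m A" and m: "1 < m" and n: "1 < CARD('n)"
    and \<rho>: "0 < \<rho>" "\<rho> < 1" and y: "\<And>i. 0 < y $ i" and Mx: "\<And>i. 0 < tensor_app m M x $ i"
    and step: "tensor_app m (tensor_diff (tensor_scale \<rho> B) A) y = tensor_app m M x"
    and \<tau>: "\<tau> = vec_min (vec_quot (tensor_app m M x) (tensor_app m M y))"
    and x': "x' = y /\<^sub>R norm y"
    and s: "s = vec_max (vec_quot (tensor_app m A x') (tensor_app m M x'))"
  shows "0 < x' $ i" and "norm x' = 1" and "0 < tensor_app m M x' $ i"
    and "tensor_app m A x' $ i \<le> s * tensor_app m M x' $ i"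
    and "\<exists>i. tensor_app m A x' $ i = s * tensor_app m M x' $ i"
    and "0 < s" and "\<rho> - (1 - \<rho>) * \<tau> / (1 - \<tau>) = s / (1 + s)"
    and "\<exists>d>0. (\<rho> / (1 - \<rho>)) *\<^sub>R tensor_app m M x' - tensor_app m A x' = d *\<^sub>R tensor_app m M x"
proof -
  have "y \<noteq> 0" using y by (metis less_irrefl zero_index)
  then have ny: "0 < norm y" by simp
  then show "norm x' = 1" by (simp add: x')
  show xpos: "0 < x' $ i" for i using y[of i] ny by (simp add: x')
  have m1: "1 \<le> m" using m by simp
  have Ay: "0 < tensor_app m A y $ i" for i
    by (rule tensor_app_pos[OF A(1) m1 A(2) n y])
  have Ax': "0 < tensor_app m A x' $ i" for i
    by (rule tensor_app_pos[OF A(1) m1 A(2) n xpos])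
  have split: "\<rho> * tensor_app m M y $ i - (1 - \<rho>) * tensor_app m A y $ i = tensor_app m M x $ i" for i
    using arg_cong[OF step, of "\<lambda>v. v $ i"]
    by (simp add: M_def tensor_app_diff tensor_app_scale algebra_simps)
  have My: "0 < tensor_app m M y $ i" for i
  proof -
    have "0 < (1 - \<rho>) * tensor_app m A y $ i" using \<rho> Ay[of i] by simp
    then have "0 < \<rho> * tensor_app m M y $ i" using split[of i] Mx[of i] by linarith
    then show ?thesis using \<rho> by (simp add: zero_less_mult_iff)
  qed
  define c where "c = inverse (norm y) ^ (m - 1)"
  have c: "0 < c" using ny by (simp add: c_def)
  have scale: "tensor_app m T x' = c *\<^sub>R tensor_app m T y" for T
    unfolding x' c_def by (rule tensor_app_scaleR)
  show Mx': "0 < tensor_app m M x' $ i" for i using c My[of i] by (simp add: scale)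
  show le: "tensor_app m A x' $ i \<le> s * tensor_app m M x' $ i" for i
  proof -
    have "tensor_app m A x' $ i / tensor_app m M x' $ i \<le> s"
      using le_vec_max[of "vec_quot (tensor_app m A x') (tensor_app m M x')" i]
      by (simp add: s vec_quot_def)
    then show ?thesis using Mx'[of i] by (simp add: pos_divide_le_eq)
  qed
  obtain i where "s = tensor_app m A x' $ i / tensor_app m M x' $ i"
    using vec_max_attained[of "vec_quot (tensor_app m A x') (tensor_app m M x')"]
    by (auto simp: s vec_quot_def)
  then have i: "tensor_app m A x' $ i = s * tensor_app m M x' $ i"
    using Mx'[of i] by simp
  then show "\<exists>i. tensor_app m A x' $ i = s * tensor_app m M x' $ i" ..
  show s0: "0 < s" using i Ax'[of i] Mx'[of i] by (simp add: zero_less_mult_iff)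
  have \<tau>_le: "\<tau> * tensor_app m M y $ j \<le> tensor_app m M x $ j" for j
    using vec_min_le[of "vec_quot (tensor_app m M x) (tensor_app m M y)" j] My[of j]
    by (simp add: \<tau> vec_quot_def pos_le_divide_eq)
  obtain j where "\<tau> = tensor_app m M x $ j / tensor_app m M y $ j"
    using vec_min_attained[of "vec_quot (tensor_app m M x) (tensor_app m M y)"]
    by (auto simp: \<tau> vec_quot_def)
  then have j: "tensor_app m M x $ j = \<tau> * tensor_app m M y $ j"
    using My[of j] by simp
  have leY: "tensor_app m A y $ k \<le> s * tensor_app m M y $ k" for k
    using le[of k] c by (simp add: scale mult.left_commute)
  have iY: "tensor_app m A y $ i = s * tensor_app m M y $ i"
    using i c by (simp add: scale mult.left_commute)
  have "\<tau> * tensor_app m M y $ i \<le> (\<rho> - (1 - \<rho>) * s) * tensor_app m M y $ i"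
    using \<tau>_le[of i] split[of i] unfolding iY by (simp add: algebra_simps)
  then have "\<tau> \<le> \<rho> - (1 - \<rho>) * s" using My[of i] by simp
  moreover have "(\<rho> - (1 - \<rho>) * s) * tensor_app m M y $ j \<le> \<tau> * tensor_app m M y $ j"
    using mult_left_mono[OF leY[of j], of "1 - \<rho>"] \<rho> split[of j] unfolding j
    by (simp add: algebra_simps)
  then have "\<rho> - (1 - \<rho>) * s \<le> \<tau>" using My[of j] by simp
  ultimately have \<tau>_eq: "\<tau> = \<rho> - (1 - \<rho>) * s" by simp
  have "1 - \<tau> = (1 - \<rho>) * (1 + s)" unfolding \<tau>_eq by (simp add: algebra_simps)
  then have "(1 - \<rho>) * \<tau> / (1 - \<tau>) = \<tau> / (1 + s)" using \<rho> by simp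
  then show "\<rho> - (1 - \<rho>) * \<tau> / (1 - \<tau>) = s / (1 + s)"
    using s0 unfolding \<tau>_eq by (simp add: field_simps)
  have "(\<rho> / (1 - \<rho>)) *\<^sub>R tensor_app m M x' - tensor_app m A x' = (c / (1 - \<rho>)) *\<^sub>R tensor_app m M x"
  proof (rule vec_eq_iff[THEN iffD2], rule allI)
    fix k
    have "(\<rho> / (1 - \<rho>)) * (c * tensor_app m M y $ k) - c * tensor_app m A y $ k
        = (c / (1 - \<rho>)) * (\<rho> * tensor_app m M y $ k - (1 - \<rho>) * tensor_app m A y $ k)"
      using \<rho> by (simp add: field_simps)
    then show "((\<rho> / (1 - \<rho>)) *\<^sub>R tensor_app m M x' - tensor_app m A x') $ k
        = ((c / (1 - \<rho>)) *\<^sub>R tensor_app m M x) $ k"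
      unfolding split by (simp add: scale)
  qed
  then show "\<exists>d>0. (\<rho> / (1 - \<rho>)) *\<^sub>R tensor_app m M x' - tensor_app m A x' = d *\<^sub>R tensor_app m M x"
    using c \<rho> by (intro exI[of _ "c / (1 - \<rho>)"]) simp
qed

text \<open>
  In dimension 1 the tensor \<open>\<rho> B - A\<close> vanishes at \<open>x\<close> by the choice of \<open>\<rho>\<close>, hence at every positive
  vector, while \<open>M x\<close> is positive.
\<close>
lemma mtni_needs_two_dims:
  fixes A B :: "'n::finite tensor"
  assumes A: "nonneg_tensor m A" "1 \<le> m"
    and x: "\<And>i. 0 < x $ i" and Mx: "\<And>i. 0 < tensor_app m (tensor_diff B A) x $ i"
    and \<rho>: "\<rho> = vec_max (vec_quot (tensor_app m A x) (tensor_app m B x))"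
    and y: "\<And>i. 0 < y $ i"
    and step: "tensor_app m (tensor_diff (tensor_scale \<rho> B) A) y = tensor_app m (tensor_diff B A) x"
  shows "1 < CARD('n)"
proof (rule ccontr)
  assume "\<not> 1 < CARD('n)"
  moreover have "0 < CARD('n)" by simp
  ultimately have "CARD('n) = 1" by linarith
  then obtain i :: 'n where i: "UNIV = {i}" by (auto simp: card_1_singleton_iff)
  then have all: "j = i" for j by auto
  have "tensor_app m A x $ i \<ge> 0"
    using A prod_list_map_pos[of "($) x"] x
    by (auto simp: tensor_app_def nonneg_tensor_def less_imp_le intro!: sum_nonneg)
  then have Bx: "0 < tensor_app m B x $ i" using Mx[of i] by (simp add: tensor_app_diff)
  obtain j where "\<rho> = tensor_app m A x $ j / tensor_app m B x $ j"
    using vec_max_attained[of "vec_quot (tensor_app m A x) (tensor_app m B x)"]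
    by (auto simp: \<rho> vec_quot_def)
  then have \<rho>': "\<rho> * tensor_app m B x $ i = tensor_app m A x $ i" using all[of j] Bx by simp
  define t where "t = y $ i / x $ i"
  have "y $ j = (t *\<^sub>R x) $ j" for j using all[of j] x[of i] by (simp add: t_def)
  then have "y = t *\<^sub>R x" by (simp add: vec_eq_iff)
  then have "tensor_app m (tensor_diff (tensor_scale \<rho> B) A) y $ i = 0"
    using \<rho>' by (simp add: tensor_app_scaleR tensor_app_diff tensor_app_scale)
  with step Mx[of i] show False by simp
qed

section \<open>Uniqueness of the positive eigenvalue\<close>

text \<open>
  An eigenvalue \<open>t \<ge> 1\<close> would give \<open>M v = (1 - t) (B v) \<le> 0\<close>, against \<open>M w > 0\<close> for the Z-tensor
  \<open>M\<close>. This bound is what makes the next lemma applicable, whose shifted tensor needs a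
  number below 1.
\<close>
lemma positive_eigenvalue_less_1:
  fixes A B :: "'n::finite tensor"
  assumes A: "nonneg_tensor m A" "weakly_irreducible m A" and m: "1 < m" and n: "1 < CARD('n)"
    and M: "Z_tensor m (tensor_diff B A)"
    and w: "\<And>i. 0 < w $ i" "\<And>i. 0 < tensor_app m (tensor_diff B A) w $ i"
    and v: "\<And>i. 0 < v $ i" and t: "0 < t" "tensor_app m A v = t *\<^sub>R tensor_app m B v"
  shows "t < 1"
proof (rule ccontr)
  assume "\<not> t < 1"
  have Mv: "tensor_app m (tensor_diff B A) v $ i \<le> 0" for i
  proof -
    have eq: "tensor_app m A v $ i = t * tensor_app m B v $ i" using t(2) by simp
    have "0 < tensor_app m A v $ i"
      using m by (intro tensor_app_pos[OF A(1) _ A(2) n v]) auto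
    then have "0 < tensor_app m B v $ i" using eq t(1) by (simp add: zero_less_mult_iff)
    then have "tensor_app m B v $ i \<le> t * tensor_app m B v $ i" using \<open>\<not> t < 1\<close> by simp
    then show ?thesis using eq by (simp add: tensor_app_diff)
  qed
  show False by (rule Z_tensor_no_sign_conflict[OF M w(1) v w(2) Mv])
qed

text \<open>
  A positive multiple of \<open>r B - A\<close> is the Z-tensor \<open>\<sigma> M - A\<close> with \<open>\<sigma> = r / (1 - r)\<close>. It annihilates \<open>v\<close>
  and, if \<open>t < r\<close>, is positive at \<open>u\<close>.
\<close>
lemma positive_eigenvalues_not_less:
  fixes A B :: "'n::finite tensor"
  assumes A: "nonneg_tensor m A" "weakly_irreducible m A" and m: "1 < m" and n: "1 < CARD('n)"
    and M: "Z_tensor m (tensor_diff B A)"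
    and u: "\<And>i. 0 < u $ i" "tensor_app m A u = t *\<^sub>R tensor_app m B u"
    and v: "\<And>i. 0 < v $ i" "tensor_app m A v = r *\<^sub>R tensor_app m B v"
    and t: "0 < t" and r: "r < 1"
  shows "\<not> t < r"
proof
  assume "t < r"
  define F where "F = tensor_diff (tensor_scale (r / (1 - r)) (tensor_diff B A)) A"
  have ZF: "Z_tensor m F"
    unfolding F_def using shifted_Z_tensor(1)[OF A(1) _ M] m t r \<open>t < r\<close> by simp
  have F: "tensor_app m F z = (1 / (1 - r)) *\<^sub>R (r *\<^sub>R tensor_app m B z - tensor_app m A z)" for z
    using r by (simp add: F_def tensor_app_diff tensor_app_scale vec_eq_iff field_simps)
  have "0 < tensor_app m A u $ i" for i
    using m by (intro tensor_app_pos[OF A(1) _ A(2) n u(1)]) auto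
  then have "0 < tensor_app m B u $ i" for i
    using t unfolding u(2) by (simp add: zero_less_mult_iff)
  then have Fu: "0 < tensor_app m F u $ i" for i
    using r \<open>t < r\<close> unfolding F u(2) by simp
  have Fv: "tensor_app m F v $ i \<le> 0" for i unfolding F v(2) by simp
  show False by (rule Z_tensor_no_sign_conflict[OF ZF u(1) v(1) Fu Fv])
qed

section \<open>Convergence of the modified tensor Noda iteration\<close>

theorem theorem4p1:
  fixes A B :: "'n::finite tensor" and m :: nat
    and \<epsilon> :: real and b :: "real ^ 'n"
    and x y :: "nat \<Rightarrow> real ^ 'n"
    and \<rho> \<tau> sbar rhobar :: "nat \<Rightarrow> real"
  assumes "1 \<le> m"
    and "gen_M_pair m A B"
    and "0 < \<epsilon>"
    and "vec_less 0 b"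
    and "MTNI m A B \<epsilon> b x y \<rho> \<tau> sbar rhobar"
    and "\<rho> 1 < 1"
  shows "\<exists>\<mu> xstar.
           rhobar \<longlonglongrightarrow> \<mu> \<and> x \<longlonglongrightarrow> xstar \<and>
           0 < \<mu> \<and>
           (\<exists>v. vec_less 0 v \<and> gen_eigenpair m A B \<mu> v) \<and>
           (\<forall>t. 0 < t \<and> (\<exists>v. vec_less 0 v \<and> gen_eigenpair m A B t v) \<longrightarrow> t = \<mu>) \<and>
           vec_less 0 xstar \<and> gen_eigenpair m A B \<mu> xstar"
proof -
  define M where "M = tensor_diff B A"
  have A: "nonneg_tensor m A" "weakly_irreducible m A"
    using assms(2) by (auto simp: gen_M_pair_def)
  obtain w where w: "\<And>i. 0 < w $ i" "\<And>i. 0 < tensor_app m M w $ i"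
    using assms(2) by (auto simp: gen_M_pair_def vec_less_def M_def tensor_app_diff)
  have ZM: "Z_tensor m M"
    using assms(2) by (auto simp: gen_M_pair_def Z_tensor_def M_def tensor_diff_def)
  obtain xhat where xhat: "vec_less 0 xhat" "tensor_app m M xhat = b" "x 0 = xhat /\<^sub>R norm xhat"
    using assms(5) unfolding MTNI_def M_def by blast
  have \<rho>0: "\<rho> 0 = vec_max (vec_quot (tensor_app m A (x 0)) (tensor_app m B (x 0)))"
    using assms(5) unfolding MTNI_def by blast
  have y: "0 < y (Suc k) $ i" for k i
    using assms(5) unfolding MTNI_def vec_less_def by (metis zero_index)
  have ystep: "tensor_app m (tensor_diff (tensor_scale (\<rho> k) B) A) (y (Suc k)) = tensor_app m M (x k)" for k
    using assms(5) unfolding MTNI_def M_def by blast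
  have \<tau>: "\<tau> k = vec_min (vec_quot (tensor_app m M (x k)) (tensor_app m M (y (Suc k))))" for k
    using assms(5) unfolding MTNI_def M_def by blast
  have \<rho>Suc: "\<rho> (Suc k) = (1 + \<epsilon>) * (\<rho> k - (1 - \<rho> k) * \<tau> k / (1 - \<tau> k))" for k
    using assms(5) unfolding MTNI_def by blast
  have xSuc: "x (Suc k) = y (Suc k) /\<^sub>R norm (y (Suc k))" for k
    using assms(5) unfolding MTNI_def by blast
  have sbar: "sbar (Suc k) = vec_max (vec_quot (tensor_app m A (x (Suc k))) (tensor_app m M (x (Suc k))))" for k
    using assms(5) unfolding MTNI_def M_def by blast
  have rhobar: "rhobar (Suc k) = sbar (Suc k) / (1 + sbar (Suc k))" for k
    using assms(5) unfolding MTNI_def by blast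
  have "xhat \<noteq> 0" using xhat(1) by (auto simp: vec_less_def)
  then have nx: "0 < inverse (norm xhat)" by simp
  have x0: "0 < x 0 $ i" for i using xhat(1) nx by (simp add: xhat(3) vec_less_def)
  have Mx0: "0 < tensor_app m M (x 0) $ i" for i
    using assms(4) nx by (simp add: xhat(2,3) tensor_app_scaleR vec_less_def)
  have n: "1 < CARD('n)"
    by (rule mtni_needs_two_dims[OF A(1) assms(1) x0 Mx0[unfolded M_def] \<rho>0 y ystep[unfolded M_def]])
  \<comment> \<open>In dimension at least 2 a weakly irreducible tensor has rows with a second index.\<close>
  have m: "1 < m"
  proof -
    obtain j js where "length js = m - 1" "j \<in> set (js :: 'n list)"
      using weakly_irreducible_row[OF A(2) n] by metis
    then show ?thesis by (cases js) auto
  qed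
  have \<rho>0_bounds: "0 < \<rho> 0" "\<rho> 0 < 1"
  proof -
    obtain i where i: "\<rho> 0 = tensor_app m A (x 0) $ i / tensor_app m B (x 0) $ i"
      using vec_max_attained[of "vec_quot (tensor_app m A (x 0)) (tensor_app m B (x 0))"]
      by (auto simp: \<rho>0 vec_quot_def)
    have "0 < tensor_app m A (x 0) $ i"
      by (rule tensor_app_pos[OF A(1) assms(1) A(2) n x0])
    moreover have "tensor_app m A (x 0) $ i < tensor_app m B (x 0) $ i"
      using Mx0[of i] by (simp add: M_def tensor_app_diff)
    ultimately show "0 < \<rho> 0" "\<rho> 0 < 1" unfolding i by auto
  qed
  note step = mtni_step[OF A m n, of "\<rho> k" "y (Suc k)" B "x k" "\<tau> k" "x (Suc k)" "sbar (Suc k)"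
      for k, folded M_def, OF _ _ y _ ystep \<tau> xSuc sbar]
  \<comment> \<open>The Noda shift \<open>\<rho> / (1 - \<rho>)\<close> as a function of \<open>s\<close>, for \<open>\<rho> = (1 + \<epsilon>) s / (1 + s)\<close>.\<close>
  have shift_of_s: "\<epsilon> * s < 1 \<and> (1 + \<epsilon>) * (s / (1 + s)) / (1 - (1 + \<epsilon>) * (s / (1 + s))) = (1 + \<epsilon>) * s / (1 - \<epsilon> * s)"
    if s: "0 < s" "(1 + \<epsilon>) * (s / (1 + s)) < 1" for s
  proof
    show "\<epsilon> * s < 1" using s by (simp add: field_simps)
    have "1 - (1 + \<epsilon>) * (s / (1 + s)) = (1 - \<epsilon> * s) / (1 + s)" using s(1) by (simp add: field_simps)
    then show "(1 + \<epsilon>) * (s / (1 + s)) / (1 - (1 + \<epsilon>) * (s / (1 + s))) = (1 + \<epsilon>) * s / (1 - \<epsilon> * s)"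
      using s(1) by simp
  qed
  have \<rho>_eq: "\<rho> (Suc k) = (1 + \<epsilon>) * (sbar (Suc k) / (1 + sbar (Suc k)))" "0 < \<rho> (Suc k)"
    if k: "0 < \<rho> k" "\<rho> k < 1" "\<And>i. 0 < tensor_app m M (x k) $ i" for k
  proof -
    show "\<rho> (Suc k) = (1 + \<epsilon>) * (sbar (Suc k) / (1 + sbar (Suc k)))"
      using step(7)[OF k] \<rho>Suc[of k] by simp
    then show "0 < \<rho> (Suc k)" using step(6)[OF k] assms(3) by simp
  qed
  \<comment> \<open>The comparison starts with the step from \<open>x 1\<close>: the first shift \<open>\<rho> 0\<close> has no factor \<open>1 + \<epsilon>\<close>.\<close>
  have sbar_le: "sbar (Suc (Suc k)) \<le> sbar (Suc k)"
    if k: "0 < \<rho> k" "\<rho> k < 1" "\<And>i. 0 < tensor_app m M (x k) $ i" and k1: "\<rho> (Suc k) < 1" for k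
  proof -
    note st = step[OF k] and \<rho>k = \<rho>_eq[OF k]
    note st' = step[of "Suc k", OF \<rho>k(2) k1 st(3)]
    obtain d where d: "0 < d" "(\<rho> (Suc k) / (1 - \<rho> (Suc k))) *\<^sub>R tensor_app m M (x (Suc (Suc k)))
        - tensor_app m A (x (Suc (Suc k))) = d *\<^sub>R tensor_app m M (x (Suc k))"
      using st'(8) by blast
    define s where "s = sbar (Suc k)"
    have s: "0 < s" "(1 + \<epsilon>) * (s / (1 + s)) < 1" using st(6) \<rho>k(1) k1 by (auto simp: s_def)
    have "s * (1 - \<epsilon> * s) < (1 + \<epsilon>) * s"
      using s(1) assms(3) by (simp add: algebra_simps add_pos_pos)
    then have "s < (1 + \<epsilon>) * s / (1 - \<epsilon> * s)"
      using shift_of_s[OF s] by (simp add: pos_less_divide_eq)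
    then have "sbar (Suc k) < \<rho> (Suc k) / (1 - \<rho> (Suc k))"
      using shift_of_s[OF s, THEN conjunct2] by (simp only: \<rho>k(1) s_def)
    then have le: "tensor_app m A (x (Suc (Suc k))) $ i
        \<le> sbar (Suc k) * tensor_app m M (x (Suc (Suc k))) $ i" for i
      using noda_step(1)[OF A ZM m n less_imp_le[OF st(6)] _ d(1) st(1) st'(1) st(3,4) d(2)] by blast
    obtain i where "tensor_app m A (x (Suc (Suc k))) $ i
        = sbar (Suc (Suc k)) * tensor_app m M (x (Suc (Suc k))) $ i"
      using st'(5) by blast
    with le[of i] st'(3)[of i] show ?thesis by simp
  qed
  \<comment> \<open>The bound on \<open>\<rho> (Suc k)\<close> is carried along because \<open>sbar_le\<close> needs two consecutive shifts below 1;
    the induction starts from \<open>\<rho> 1 < 1\<close>.\<close>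
  have inv: "0 < \<rho> k \<and> \<rho> k < 1 \<and> (\<forall>i. 0 < tensor_app m M (x k) $ i) \<and> \<rho> (Suc k) < 1" for k
  proof (induction k)
    case 0
    then show ?case using \<rho>0_bounds Mx0 assms(6) by simp
  next
    case (Suc k)
    then have k: "0 < \<rho> k" "\<rho> k < 1" "\<And>i. 0 < tensor_app m M (x k) $ i" and k1: "\<rho> (Suc k) < 1"
      by auto
    note st = step[OF k] and \<rho>k = \<rho>_eq[OF k]
    note st' = step[of "Suc k", OF \<rho>k(2) k1 st(3)]
    have "sbar (Suc (Suc k)) / (1 + sbar (Suc (Suc k))) \<le> sbar (Suc k) / (1 + sbar (Suc k))"
      using sbar_le[OF k k1] st(6) st'(6) by (simp add: field_simps)
    then have "\<rho> (Suc (Suc k)) \<le> \<rho> (Suc k)"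
      unfolding \<rho>_eq(1)[OF \<rho>k(2) k1 st(3)] \<rho>k(1) using assms(3) by (intro mult_left_mono) auto
    then show ?case using \<rho>k(2) k1 st(3) by simp
  qed
  have Mx: "0 < tensor_app m M (x k) $ i" for k i using inv by blast
  have \<rho>b: "0 < \<rho> k" "\<rho> k < 1" for k using inv by auto
  note run = step[OF \<rho>b Mx]
  have "\<exists>d>0. (\<rho> (Suc k) / (1 - \<rho> (Suc k))) *\<^sub>R tensor_app m M (x (Suc (Suc k)))
        - tensor_app m A (x (Suc (Suc k))) = d *\<^sub>R tensor_app m M (x (Suc k))" for k
    by (rule run(8))
  then obtain d where d: "\<And>k. 0 < d k"
    "\<And>k. (\<rho> (Suc k) / (1 - \<rho> (Suc k))) *\<^sub>R tensor_app m M (x (Suc (Suc k)))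
        - tensor_app m A (x (Suc (Suc k))) = d k *\<^sub>R tensor_app m M (x (Suc k))"
    by metis
  have \<sigma>: "\<rho> (Suc k) / (1 - \<rho> (Suc k)) = (1 + \<epsilon>) * sbar (Suc k) / (1 - \<epsilon> * sbar (Suc k))"
    "\<epsilon> * sbar (Suc k) < 1" for k
    using shift_of_s[of "sbar (Suc k)"] \<rho>_eq(1)[OF \<rho>b Mx] run(6)[of k] \<rho>b(2)[of "Suc k"] by auto
  have dec: "decseq (\<lambda>k. sbar (Suc k))"
    by (rule decseq_SucI) (use sbar_le[OF \<rho>b Mx \<rho>b(2)] in auto)
  obtain l z where l: "0 < l" "(\<lambda>k. sbar (Suc k)) \<longlonglongrightarrow> l" and xz: "(\<lambda>k. x (Suc k)) \<longlonglongrightarrow> z"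
    and z: "\<And>i. 0 < z $ i" "tensor_app m A z = l *\<^sub>R tensor_app m M z"
    using noda_converges[OF A ZM m n assms(3), of "\<lambda>k. x (Suc k)" "\<lambda>k. sbar (Suc k)"
        "\<lambda>k. \<rho> (Suc k) / (1 - \<rho> (Suc k))" d, OF run(1,2,3,4,5,6) dec \<sigma>(2) \<sigma>(1) d]
    by blast
  define \<mu> where "\<mu> = l / (1 + l)"
  have \<mu>: "0 < \<mu>" "\<mu> < 1" using l(1) by (auto simp: \<mu>_def)
  have Az: "tensor_app m A z = \<mu> *\<^sub>R tensor_app m B z"
  proof (rule vec_eq_iff[THEN iffD2], rule allI)
    fix i
    have "tensor_app m A z $ i = l * (tensor_app m B z $ i - tensor_app m A z $ i)"
      using arg_cong[OF z(2), of "\<lambda>v. v $ i"] by (simp add: M_def tensor_app_diff)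
    then show "tensor_app m A z $ i = (\<mu> *\<^sub>R tensor_app m B z) $ i"
      using l(1) by (simp add: \<mu>_def field_simps)
  qed
  have "z \<noteq> 0" using z(1) by (metis less_irrefl zero_index)
  then have eig: "vec_less 0 z" "gen_eigenpair m A B \<mu> z"
    using z(1) Az by (auto simp: vec_less_def gen_eigenpair_def)
  have "(\<lambda>k. rhobar (Suc k)) \<longlonglongrightarrow> \<mu>"
    unfolding rhobar \<mu>_def using l by (intro tendsto_intros) auto
  then have "rhobar \<longlonglongrightarrow> \<mu>" by (rule LIMSEQ_imp_Suc)
  moreover have "x \<longlonglongrightarrow> z" using xz by (rule LIMSEQ_imp_Suc)
  moreover have "t = \<mu>" if t: "0 < t" "vec_less 0 v" "gen_eigenpair m A B t v" for t v
  proof -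
    have v: "\<And>i. 0 < v $ i" "tensor_app m A v = t *\<^sub>R tensor_app m B v"
      using t by (auto simp: vec_less_def gen_eigenpair_def)
    have t1: "t < 1"
      using positive_eigenvalue_less_1[OF A m n ZM[unfolded M_def] w[unfolded M_def] v(1) t(1) v(2)] .
    have "\<not> t < \<mu>"
      using positive_eigenvalues_not_less[OF A m n ZM[unfolded M_def] v z(1) Az t(1) \<mu>(2)] .
    moreover have "\<not> \<mu> < t"
      using positive_eigenvalues_not_less[OF A m n ZM[unfolded M_def] z(1) Az v \<mu>(1) t1] .
    ultimately show "t = \<mu>" by simp
  qed
  ultimately show ?thesis using \<mu>(1) eig by blast
qed

end
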